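(* Let $\Gamma\subset S^2$ be a simple cubic planar graph (simple meaning no loops and no multiple edges) and let $\widehat{\Gamma}$ be its planar dual graph. Let $P_{\widehat{\Gamma}}$ be the chromatic polynomial of $\widehat{\Gamma}$, whose value $P_{\widehat\Gamma}(c)$ is the number of proper colorings of the vertices of $\widehat\Gamma$ with $c$ colors. Let $\mathbf{F}_q$ be a field with $q$ elements, and let $\mathcal{M}=\mathcal{M}(\Gamma)$ be the moduli space of $\mathbf{P}^1$-colorings of the faces of $\Gamma$ modulo $\mathrm{PGL}_2$. Then $$\#\mathcal{M}(\mathbf{F}_q)=\frac{1}{q^3-q}\,P_{\widehat{\Gamma}}(q+1).$$
   Context: A cubic planar graph is a finite connected graph embedded in $S^2$ in which every vertex has degree three. If it has $2g+2$ vertices, it has $3g+3$ edges and $g+3$ faces (the connected components of $S^2\setminus\Gamma$). The dual graph $\widehat\Gamma$ has one vertex for each face of $\Gamma$ and one edge for each edge of $\Gamma$, joining the faces on its two sides. $\mathcal{M}_{fr}(\Gamma)$ is the open subscheme of $(\mathbf{P}^1)^{g+3}$ (factors indexed by the faces of $\Gamma$, defined over $\mathbf{Z}$) consisting of tuples $(z_a)_a$ such that $z_a\neq z_b$ whenever the faces $a$ and $b$ are separated by an edge of $\Gamma$ (so it is empty if some edge has the same face on both sides). The group $\mathrm{PGL}_2$ acts diagonally, and freely, on $\mathcal{M}_{fr}(\Gamma)$, and $\mathcal{M}(\Gamma):=\mathcal{M}_{fr}(\Gamma)/\mathrm{PGL}_2$. *)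

theory Defs
  imports
    "HOL-Analysis.Analysis"
    "HOL-Algebra.Algebraic_Closure_Type"
    "HOL-Computational_Algebra.Polynomial"
begin

section \<open>Multigraphs\<close>

text \<open>
  \<open>ends G e\<close> is the set of end vertices of the edge \<open>e\<close>: two elements for an ordinary edge,
  one element for a loop.
\<close>

record ('v, 'e) mgraph =
  verts :: "'v set"
  edges :: "'e set"
  ends :: "'e \<Rightarrow> 'v set"

text \<open>A loop contributes two to the degree of its end vertex.\<close>

definition degree_of :: "('v, 'e) mgraph \<Rightarrow> 'v \<Rightarrow> nat" where
  "degree_of G v =
     card {e \<in> edges G. v \<in> ends G e} + card {e \<in> edges G. ends G e = {v}}"

definition cubic :: "('v, 'e) mgraph \<Rightarrow> bool" where
  "cubic G \<longleftrightarrow> (\<forall>v \<in> verts G. degree_of G v = 3)"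

definition connected_mgraph :: "('v, 'e) mgraph \<Rightarrow> bool" where
  "connected_mgraph G \<longleftrightarrow> verts G \<noteq> {} \<and>
     (\<forall>u \<in> verts G. \<forall>v \<in> verts G. (u, v) \<in> {(x, y). \<exists>e \<in> edges G. ends G e = {x, y}}\<^sup>*)"

definition simple_mgraph :: "('v, 'e) mgraph \<Rightarrow> bool" where
  "simple_mgraph G \<longleftrightarrow> (\<forall>e \<in> edges G. card (ends G e) = 2) \<and> inj_on (ends G) (edges G)"

text \<open>
  The case \<open>u = v\<close> is included below, so a graph with a loop has no proper coloring.
\<close>

definition proper_colorings :: "('v, 'e) mgraph \<Rightarrow> 'c set \<Rightarrow> ('v \<Rightarrow> 'c) set" where
  "proper_colorings G C =
     {f \<in> verts G \<rightarrow>\<^sub>E C. \<forall>e \<in> edges G. \<forall>u v. ends G e = {u, v} \<longrightarrow> f u \<noteq> f v}"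

definition chromatic_poly :: "('v, 'e) mgraph \<Rightarrow> real poly" where
  "chromatic_poly G =
     (THE p. \<forall>c. poly p (real c) = real (card (proper_colorings G {..<c})))"

text \<open>
  The description is proper for every graph with finitely many vertices.  For existence, count
  the colorings by the set of colors that they use.
\<close>

lemma recolor:
  assumes wf: "\<And>e. e \<in> edges G \<Longrightarrow> ends G e \<subseteq> verts G"
    and g: "bij_betw g A B"
    and f: "f \<in> proper_colorings G A" "f ` verts G = A"
  shows "(\<lambda>v \<in> verts G. g (f v)) \<in> {f \<in> proper_colorings G B. f ` verts G = B}"
proof -
  have fA: "f v \<in> A" if "v \<in> verts G" for v
    using f(2) that by blast
  have "(\<lambda>v \<in> verts G. g (f v)) ` verts G = g ` (f ` verts G)"
    by (auto simp: image_iff)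
  also have "\<dots> = B"
    using f(2) g by (simp add: bij_betw_def)
  finally have im: "(\<lambda>v \<in> verts G. g (f v)) ` verts G = B" .
  have "(\<lambda>v \<in> verts G. g (f v)) u \<noteq> (\<lambda>v \<in> verts G. g (f v)) v"
    if e: "e \<in> edges G" "ends G e = {u, v}" for e u v
  proof -
    have uv: "u \<in> verts G" "v \<in> verts G"
      using wf[OF e(1)] e(2) by auto
    moreover have "f u \<noteq> f v"
      using f(1) e unfolding proper_colorings_def by blast
    ultimately show ?thesis
      using fA bij_betw_imp_inj_on[OF g] by (simp add: inj_on_eq_iff)
  qed
  moreover have "(\<lambda>v \<in> verts G. g (f v)) \<in> verts G \<rightarrow>\<^sub>E B"
    using fA bij_betw_apply[OF g] by auto
  ultimately show ?thesis
    using im unfolding proper_colorings_def by blast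
qed

lemma card_recolor:
  assumes wf: "\<And>e. e \<in> edges G \<Longrightarrow> ends G e \<subseteq> verts G"
    and g: "bij_betw g A B"
  shows "card {f \<in> proper_colorings G A. f ` verts G = A} =
         card {f \<in> proper_colorings G B. f ` verts G = B}" (is "card ?X = card ?Y")
proof (rule bij_betw_same_card)
  let ?h = "inv_into A g"
  have h: "bij_betw ?h B A"
    using g by (rule bij_betw_inv_into)
  have ext: "f \<in> extensional (verts G)" if "f \<in> proper_colorings G C" for f and C :: "'x set"
    using that by (auto simp: proper_colorings_def PiE_def)
  show "bij_betw (\<lambda>f. \<lambda>v \<in> verts G. g (f v)) ?X ?Y"
  proof (rule bij_betw_byWitness[where f' = "\<lambda>f. \<lambda>v \<in> verts G. ?h (f v)"])
    show "\<forall>f \<in> ?X. (\<lambda>v \<in> verts G. ?h ((\<lambda>v \<in> verts G. g (f v)) v)) = f"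
    proof
      fix f assume f: "f \<in> ?X"
      show "(\<lambda>v \<in> verts G. ?h ((\<lambda>v \<in> verts G. g (f v)) v)) = f"
      proof (rule extensionalityI[of _ "verts G"])
        fix v assume v: "v \<in> verts G"
        then have "f v \<in> A" using f by blast
        then show "(\<lambda>v \<in> verts G. ?h ((\<lambda>v \<in> verts G. g (f v)) v)) v = f v"
          using v bij_betw_inv_into_left[OF g] by simp
      qed (use f ext in auto)
    qed
    show "\<forall>f \<in> ?Y. (\<lambda>v \<in> verts G. g ((\<lambda>v \<in> verts G. ?h (f v)) v)) = f"
    proof
      fix f assume f: "f \<in> ?Y"
      show "(\<lambda>v \<in> verts G. g ((\<lambda>v \<in> verts G. ?h (f v)) v)) = f"
      proof (rule extensionalityI[of _ "verts G"])
        fix v assume v: "v \<in> verts G"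
        then have "f v \<in> B" using f by blast
        then show "(\<lambda>v \<in> verts G. g ((\<lambda>v \<in> verts G. ?h (f v)) v)) v = f v"
          using v bij_betw_inv_into_right[OF g] by simp
      qed (use f in \<open>auto simp: proper_colorings_def PiE_def\<close>)
    qed
    show "(\<lambda>f. \<lambda>v \<in> verts G. g (f v)) ` ?X \<subseteq> ?Y"
      using recolor[OF wf g] by blast
    show "(\<lambda>f. \<lambda>v \<in> verts G. ?h (f v)) ` ?Y \<subseteq> ?X"
      using recolor[OF wf h] by blast
  qed
qed

lemma card_proper_colorings:
  fixes G :: "('v, 'e) mgraph" and C :: "'c set"
  assumes fin: "finite (verts G)"
    and wf: "\<And>e. e \<in> edges G \<Longrightarrow> ends G e \<subseteq> verts G"
    and C: "finite C"
  shows "card (proper_colorings G C) =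
    (\<Sum>k\<le>card (verts G).
       card {f \<in> proper_colorings G {..<k}. f ` verts G = {..<k}} * (card C choose k))"
proof -
  define N where "N = (\<lambda>k::nat. card {f \<in> proper_colorings G {..<k}. f ` verts G = {..<k}})"
  define F where "F = (\<lambda>S :: 'c set. {f \<in> proper_colorings G S. f ` verts G = S})"
  define W where "W = {S. S \<subseteq> C \<and> card S \<le> card (verts G)}"
  have finW: "finite W"
    unfolding W_def using C by simp
  have finF: "finite (F S)" if "S \<in> W" for S
  proof -
    have "finite S" using that C finite_subset unfolding W_def by blast
    then have "finite (verts G \<rightarrow>\<^sub>E S)" using fin by (simp add: finite_PiE)
    then show ?thesis
      by (rule rev_finite_subset) (auto simp: F_def proper_colorings_def)
  qed
  have "proper_colorings G C = (\<Union>S\<in>W. F S)"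
  proof
    show "proper_colorings G C \<subseteq> (\<Union>S\<in>W. F S)"
    proof
      fix f assume f: "f \<in> proper_colorings G C"
      have "f ` verts G \<in> W"
        using f card_image_le[OF fin, of f] by (auto simp: W_def proper_colorings_def)
      moreover have "f \<in> F (f ` verts G)"
        using f by (auto simp: F_def proper_colorings_def PiE_def)
      ultimately show "f \<in> (\<Union>S\<in>W. F S)" by blast
    qed
    show "(\<Union>S\<in>W. F S) \<subseteq> proper_colorings G C"
      by (auto simp: F_def W_def proper_colorings_def PiE_def Pi_def)
  qed
  also have "card \<dots> = (\<Sum>S\<in>W. card (F S))"
    by (rule card_UN_disjoint) (use finW finF in \<open>auto simp: F_def\<close>)
  also have "\<dots> = (\<Sum>S\<in>W. N (card S))"
  proof (rule sum.cong)
    fix S assume "S \<in> W"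
    then have "finite S" using C finite_subset unfolding W_def by blast
    then obtain h where h: "bij_betw h S {..<card S}"
      using ex_bij_betw_finite_nat by (auto simp: atLeast0LessThan)
    show "card (F S) = N (card S)"
      unfolding F_def N_def by (rule card_recolor[OF wf h])
  qed simp
  also have "\<dots> = (\<Sum>k\<le>card (verts G). \<Sum>S | S \<in> W \<and> card S = k. N (card S))"
    by (rule sum.group[symmetric]) (use finW in \<open>auto simp: W_def\<close>)
  also have "\<dots> = (\<Sum>k\<le>card (verts G). N k * (card C choose k))"
  proof (rule sum.cong)
    fix k assume "k \<in> {..card (verts G)}"
    then have "{S. S \<in> W \<and> card S = k} = {S. S \<subseteq> C \<and> card S = k}"
      by (auto simp: W_def)
    then show "(\<Sum>S | S \<in> W \<and> card S = k. N (card S)) = N k * (card C choose k)"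
      using n_subsets[OF C, of k] by simp
  qed simp
  finally show ?thesis unfolding N_def .
qed

lemma chromatic_poly_ex1:
  assumes fin: "finite (verts G)"
    and wf: "\<And>e. e \<in> edges G \<Longrightarrow> ends G e \<subseteq> verts G"
  shows "\<exists>!p. \<forall>c. poly p (real c) = real (card (proper_colorings G {..<c}))"
proof -
  define N where "N = (\<lambda>k::nat. card {f \<in> proper_colorings G {..<k}. f ` verts G = {..<k}})"
  define p :: "real poly" where "p =
    (\<Sum>k\<le>card (verts G). Polynomial.smult (real (N k) / fact k) (\<Prod>i = 0..<k. [:- real i, 1:]))"
  have p: "poly p (real c) = real (card (proper_colorings G {..<c}))" for c
    using card_proper_colorings[OF fin wf, of "{..<c}"]
    by (simp add: p_def N_def poly_sum poly_prod binomial_gbinomial gbinomial_prod_rev)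
  show ?thesis
  proof (rule ex1I[of _ p])
    fix p' assume p': "\<forall>c. poly p' (real c) = real (card (proper_colorings G {..<c}))"
    have "range real \<subseteq> {x. poly (p' - p) x = 0}"
      using p p' by auto
    moreover have "infinite (range real)"
      by (simp add: finite_image_iff inj_on_def)
    ultimately have "infinite {x. poly (p' - p) x = 0}"
      using finite_subset by blast
    then show "p' = p"
      using poly_roots_finite[of "p' - p"] by auto
  qed (use p in simp)
qed

lemma poly_chromatic_poly:
  assumes "finite (verts G)"
    and "\<And>e. e \<in> edges G \<Longrightarrow> ends G e \<subseteq> verts G"
  shows "poly (chromatic_poly G) (real c) = real (card (proper_colorings G {..<c}))"
  using theI'[OF chromatic_poly_ex1[OF assms]] unfolding chromatic_poly_def by blast


section \<open>Graphs embedded in the 2-sphere\<close>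

abbreviation S2 :: "(real^3) set" where
  "S2 \<equiv> sphere 0 1"

text \<open>
  Vertices are points of the sphere; an edge is the image of a simple path in the sphere,
  including its end points.  The path is closed exactly when the edge is a loop.
\<close>

type_synonym sphere_graph = "(real^3, (real^3) set) mgraph"

definition embedded_graph :: "sphere_graph \<Rightarrow> bool" where
  "embedded_graph G \<longleftrightarrow>
     finite (verts G) \<and> finite (edges G) \<and> verts G \<subseteq> S2 \<and>
     (\<forall>e \<in> edges G. \<exists>g. simple_path g \<and> path_image g = e \<and> e \<subseteq> S2 \<and>
        ends G e = {pathstart g, pathfinish g} \<and> e \<inter> verts G = {pathstart g, pathfinish g}) \<and>
     (\<forall>e \<in> edges G. \<forall>e' \<in> edges G. e \<noteq> e' \<longrightarrow> e \<inter> e' \<subseteq> verts G)"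

definition cubic_planar_graph :: "sphere_graph \<Rightarrow> bool" where
  "cubic_planar_graph G \<longleftrightarrow> embedded_graph G \<and> connected_mgraph G \<and> cubic G"

definition support :: "sphere_graph \<Rightarrow> (real^3) set" where
  "support G = verts G \<union> \<Union>(edges G)"

definition faces :: "sphere_graph \<Rightarrow> (real^3) set set" where
  "faces G = components (S2 - support G)"

text \<open>
  The faces on the two sides of \<open>e\<close> are those having \<open>e\<close> in their boundary; there is only one
  such face when both sides of \<open>e\<close> lie in the same face.
\<close>

definition sides :: "sphere_graph \<Rightarrow> (real^3) set \<Rightarrow> (real^3) set set" where
  "sides G e = {a \<in> faces G. e \<subseteq> closure a}"

definition dual_graph :: "sphere_graph \<Rightarrow> ((real^3) set, (real^3) set) mgraph" where
  "dual_graph G = \<lparr>verts = faces G, edges = edges G, ends = sides G\<rparr>"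


section \<open>The projective line and the moduli space of colorings\<close>

text \<open>Points of \<open>\<^bold>P\<^sup>1(K)\<close> are the lines through the origin in \<open>K\<^sup>2\<close>.\<close>

definition P1 :: "('k::field ^ 2) set set" where
  "P1 = {range (\<lambda>c. c *s v) | v. v \<noteq> 0}"

text \<open>
  The elements of \<open>PGL\<^sub>2(K)\<close>, represented by the permutations of \<open>\<^bold>P\<^sup>1(K)\<close> that invertible
  matrices induce; two matrices induce the same permutation iff they are proportional.
\<close>

definition PGL2 :: "(('k::field ^ 2) set \<Rightarrow> ('k ^ 2) set) set" where
  "PGL2 = {\<lambda>L \<in> P1. (\<lambda>v. A *v v) ` L | A. invertible A}"

text \<open>The \<open>K\<close>-points of the scheme of framed colorings, for a field \<open>K\<close>.\<close>

definition M_fr :: "sphere_graph \<Rightarrow> ((real^3) set \<Rightarrow> ('k::field ^ 2) set) set" where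
  "M_fr G =
     {z \<in> faces G \<rightarrow>\<^sub>E P1. \<forall>e \<in> edges G. \<forall>a b. sides G e = {a, b} \<longrightarrow> z a \<noteq> z b}"

definition same_orbit ::
    "sphere_graph \<Rightarrow>
     (((real^3) set \<Rightarrow> ('k::field ^ 2) set) \<times> ((real^3) set \<Rightarrow> ('k ^ 2) set)) set" where
  "same_orbit G =
     {(z, w). z \<in> M_fr G \<and> w \<in> M_fr G \<and> (\<exists>\<phi> \<in> PGL2. w = (\<lambda>a \<in> faces G. \<phi> (z a)))}"

text \<open>
  Over an algebraically closed field \<open>K\<close> the \<open>K\<close>-points of the quotient \<open>M_fr / PGL\<^sub>2\<close> by the
  free action are the orbits of \<open>PGL\<^sub>2(K)\<close> on the \<open>K\<close>-points of \<open>M_fr\<close>.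
\<close>

definition M_geom :: "sphere_graph \<Rightarrow> ((real^3) set \<Rightarrow> ('k::alg_closed_field ^ 2) set) set set"
  where "M_geom G = M_fr G // same_orbit G"

text \<open>The \<open>q\<close>-power Frobenius on the homogeneous coordinates of points and of colorings.\<close>

definition frob_P1 :: "nat \<Rightarrow> ('k::field ^ 2) set \<Rightarrow> ('k ^ 2) set" where
  "frob_P1 q L = (\<lambda>v. \<chi> i. (v $ i) ^ q) ` L"

definition frob :: "nat \<Rightarrow> sphere_graph \<Rightarrow>
    ((real^3) set \<Rightarrow> ('k::field ^ 2) set) \<Rightarrow> ((real^3) set \<Rightarrow> ('k ^ 2) set)" where
  "frob q G z = (\<lambda>a \<in> faces G. frob_P1 q (z a))"

text \<open>
  For \<open>'f\<close> a field with \<open>q\<close> elements, the \<open>'f\<close>-points of the scheme \<open>M_fr / PGL\<^sub>2\<close> are its points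
  over the algebraic closure of \<open>'f\<close> that the \<open>q\<close>-power Frobenius fixes.  An orbit is fixed if
  it is mapped onto itself; it is not required to contain a coloring with coordinates in \<open>'f\<close>.
\<close>

definition M_points ::
    "'f::{field, finite} itself \<Rightarrow> sphere_graph \<Rightarrow>
     ((real^3) set \<Rightarrow> ('f alg_closure ^ 2) set) set set" where
  "M_points _ G = {orb \<in> M_geom G. frob CARD('f) G ` orb = orb}"

end

theory Submission
  imports Defs "HOL-Complex_Analysis.Contour_Integration"
begin

text \<open>
  Let \<open>q\<close> be the number of elements of the finite field and \<open>K\<close> its algebraic closure.  A vertex of \<open>\<Gamma>\<close>
  has three edges and three faces \<open>a\<close>, \<open>b\<close>, \<open>c\<close> around it, any two of them separated by one of the edges
  (\<open>three_faces_at_vertex\<close>).  So every proper coloring of the faces, with any colors, has three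
  different values at \<open>a\<close>, \<open>b\<close>, \<open>c\<close>.  (If two of these faces coincide, there are no proper colorings at
  all, and both sides of the claim are zero.)

  Since \<open>PGL\<^sub>2(K)\<close> acts simply transitively on triples of distinct points of the projective line, every
  orbit of colorings over \<open>K\<close> contains exactly one coloring with the values \<open>\<infinity>\<close>, \<open>0\<close>, \<open>1\<close> at \<open>a\<close>, \<open>b\<close>, \<open>c\<close>.
  Frobenius fixes \<open>\<infinity>\<close>, \<open>0\<close>, \<open>1\<close>, so an orbit is stable under Frobenius iff Frobenius fixes its normalised
  coloring (\<open>rational_orbits\<close>), which means that this coloring takes its values among the \<open>q + 1\<close>
  fixed points of Frobenius on the projective line.

  Hence the points of the moduli space over the finite field correspond to the proper colorings of the
  dual graph with \<open>q + 1\<close> colors in which the colors of \<open>a\<close>, \<open>b\<close>, \<open>c\<close> are prescribed.  By symmetry in the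
  colors their number does not depend on the three prescribed colors; as there are
  \<open>(q + 1) q (q - 1) = q\<^sup>3 - q\<close> possible triples, the number of all proper colorings is \<open>q\<^sup>3 - q\<close> times as
  large (\<open>card_normalised_colorings\<close>).

  The edges are arbitrary continuous arcs, so the faces around a vertex, and also the finiteness of the
  set of faces (\<open>finite_faces\<close>), take some plane topology.  By the Jordan curve theorem, the arcs that
  leave a point divide a small disc into sectors.  Janiszewski's theorem shows that near the centre each
  sector lies in a single face, even if the rest of the graph returns to the disc
  (\<open>nearby_points_stay_connected\<close>, \<open>germ_sectors\<close>).
\<close>

section \<open>Sectors of a plane disc\<close>

lemma first_hit:
  fixes g :: "real \<Rightarrow> 'a::t2_space"
  assumes "continuous_on {0..1} g" "closed C" "g 1 \<in> C"
  obtains t where "0 \<le> t" "t \<le> 1" "g t \<in> C" "\<And>u. \<lbrakk>0 \<le> u; u < t\<rbrakk> \<Longrightarrow> g u \<notin> C"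
proof -
  let ?T = "{0..1} \<inter> g -` C"
  have "closed ?T"
    by (rule continuous_closed_preimage) (use assms in auto)
  then have "compact ?T"
    by (metis compact_Icc compact_Int_closed inf.left_idem)
  moreover have "?T \<noteq> {}"
    using assms(3) by (metis IntI atLeastAtMost_iff empty_iff order_refl vimageI zero_le_one)
  ultimately obtain t where t: "t \<in> ?T" "\<And>u. u \<in> ?T \<Longrightarrow> t \<le> u"
    using compact_attains_inf by metis
  show ?thesis
  proof
    show "g u \<notin> C" if "0 \<le> u" "u < t" for u
      using t(1) t(2)[of u] that by auto
  qed (use t in auto)
qed

text \<open>
  Points near the origin that arcs leaving the origin do not separate in a large disc are not
  separated in a small disc either, although a connecting path in the large disc may make a detour.
  By Janiszewski's theorem it suffices to write the union of the arcs and the annulus between the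
  discs as a union of two sets with connected intersection, neither of which separates the two
  points.  One is the annulus with the part of each arc from its first exit of the small disc on,
  which stays away from the origin; the other is the large circle with all the arcs.
\<close>

lemma nearby_points_stay_connected:
  fixes \<gamma> :: "'i \<Rightarrow> real \<Rightarrow> complex"
  assumes fin: "finite I"
    and r: "0 < r" and s: "0 < s"
    and arc: "\<And>i. i \<in> I \<Longrightarrow> arc (\<gamma> i)"
    and start: "\<And>i. i \<in> I \<Longrightarrow> pathstart (\<gamma> i) = 0"
    and finish: "\<And>i. i \<in> I \<Longrightarrow> pathfinish (\<gamma> i) \<in> sphere 0 r"
    and sr: "s \<le> r"
  defines "Y \<equiv> (\<Union>i\<in>I. path_image (\<gamma> i))"
  shows "\<exists>\<delta>>0. \<delta> \<le> s \<and> (\<forall>y\<in>ball 0 \<delta>. \<forall>y'\<in>ball 0 \<delta>.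
    connected_component (ball 0 r - Y) y y' \<longrightarrow> connected_component (ball 0 s - Y) y y')"
proof -
  have "\<exists>t. 0 < t \<and> t \<le> 1 \<and> (\<forall>u\<in>{0..<t}. norm (\<gamma> i u) < s)" if i: "i \<in> I" for i
  proof -
    obtain t where t: "0 \<le> t" "t \<le> 1" "\<gamma> i t \<in> - ball 0 s"
      "\<And>u. \<lbrakk>0 \<le> u; u < t\<rbrakk> \<Longrightarrow> \<gamma> i u \<notin> - ball 0 s"
    proof (rule first_hit)
      show "continuous_on {0..1} (\<gamma> i)"
        using arc[OF i] by (simp add: arc_def path_def)
      show "\<gamma> i 1 \<in> - ball 0 s"
        using finish[OF i] sr by (simp add: pathfinish_def)
    qed auto
    moreover have "t \<noteq> 0"
      using t(3) start[OF i] s by (auto simp: pathstart_def)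
    ultimately show ?thesis
      by (intro exI[of _ t]) auto
  qed
  then obtain t where t: "\<And>i. i \<in> I \<Longrightarrow> 0 < t i \<and> t i \<le> 1 \<and> (\<forall>u\<in>{0..<t i}. norm (\<gamma> i u) < s)"
    by metis
  \<comment> \<open>\<open>O1 i\<close> is the part of the \<open>i\<close>-th arc from its first exit of the small disc on; it may re-enter.\<close>
  define O1 where "O1 = (\<lambda>i. \<gamma> i ` {t i..1})"
  define K1 where "K1 = (cball 0 r - ball 0 s) \<union> (\<Union>i\<in>I. O1 i)"
  define K2 where "K2 = sphere 0 r \<union> Y"
  have cO: "compact (O1 i)" and conO: "connected (O1 i)" if "i \<in> I" for i
  proof -
    have "continuous_on {t i..1} (\<gamma> i)"
      using arc[OF that] t[OF that] by (auto simp: arc_def path_def intro: continuous_on_subset)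
    then show "compact (O1 i)" "connected (O1 i)"
      unfolding O1_def by (auto intro: compact_continuous_image connected_continuous_image)
  qed
  have O1Y: "O1 i \<subseteq> path_image (\<gamma> i)" if "i \<in> I" for i
    using t[OF that] by (auto simp: O1_def path_image_def)
  have O1far: "\<gamma> i u \<in> O1 i" if "i \<in> I" "u \<in> {0..1}" "s \<le> norm (\<gamma> i u)" for i u
    using t[OF that(1)] that(2,3) unfolding O1_def by force
  have O10: "0 \<notin> O1 i" if i: "i \<in> I" for i
  proof
    assume "0 \<in> O1 i"
    then obtain u where u: "u \<in> {t i..1}" "\<gamma> i u = \<gamma> i 0"
      using start[OF i] by (auto simp: O1_def pathstart_def)
    then have "u = 0"
      using arc[OF i] t[OF i] by (auto simp: arc_def inj_on_def)
    with u t[OF i] show False by auto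
  qed
  have "open (- (\<Union>i\<in>I. O1 i))"
    using fin cO by (auto intro!: open_Compl closed_UN compact_imp_closed)
  moreover have "0 \<in> - (\<Union>i\<in>I. O1 i)"
    using O10 by auto
  ultimately obtain \<epsilon> where \<epsilon>: "0 < \<epsilon>" "ball 0 \<epsilon> \<subseteq> - (\<Union>i\<in>I. O1 i)"
    by (meson open_contains_ball)
  show ?thesis
  proof (intro exI[of _ "min \<epsilon> s"] conjI ballI impI)
    show "0 < min \<epsilon> s" "min \<epsilon> s \<le> s"
      using \<epsilon> s by auto
    fix y y' :: complex
    assume y: "y \<in> ball 0 (min \<epsilon> s)" and y': "y' \<in> ball 0 (min \<epsilon> s)"
      and yy': "connected_component (ball 0 r - Y) y y'"
    have "connected_component (- (K1 \<union> K2)) y y'"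
    proof (rule Janiszewski)
      show "compact K1"
        unfolding K1_def using fin cO by (auto intro!: compact_Un compact_UN compact_diff)
      show "closed K2"
        unfolding K2_def Y_def using fin arc
        by (intro closed_Un closed_UN) (auto intro: compact_imp_closed compact_arc_image)
      \<comment> \<open>Connected because every \<open>O1 i\<close> reaches the large circle.\<close>
      have "K1 \<inter> K2 = (\<Union>i\<in>I. sphere 0 r \<union> O1 i) \<union> sphere 0 r"
      proof
        show "K1 \<inter> K2 \<subseteq> (\<Union>i\<in>I. sphere 0 r \<union> O1 i) \<union> sphere 0 r"
          using O1far unfolding K1_def K2_def Y_def path_image_def by fastforce
        show "(\<Union>i\<in>I. sphere 0 r \<union> O1 i) \<union> sphere 0 r \<subseteq> K1 \<inter> K2"
          using O1Y sr unfolding K1_def K2_def Y_def by fastforce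
      qed
      moreover have "connected ((\<Union>i\<in>I. sphere 0 r \<union> O1 i) \<union> sphere 0 r)"
      proof (cases "I = {}")
        case True
        then show ?thesis by (simp add: connected_sphere)
      next
        case False
        have "connected (sphere (0::complex) r)" by (simp add: connected_sphere)
        moreover have "connected (sphere 0 r \<union> O1 i)" if "i \<in> I" for i
        proof (rule connected_Un)
          have "pathfinish (\<gamma> i) \<in> O1 i"
            using t[OF that] by (auto simp: O1_def pathfinish_def)
          then show "sphere 0 r \<inter> O1 i \<noteq> {}" using finish[OF that] by auto
        qed (use conO that in \<open>auto simp: connected_sphere\<close>)
        moreover have "sphere (0::complex) r \<noteq> {}" using r by simp
        ultimately have "connected (\<Union>i\<in>I. sphere 0 r \<union> O1 i)"
          by (intro connected_Union) (use False in auto)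
        moreover have "(\<Union>i\<in>I. sphere 0 r \<union> O1 i) \<union> sphere 0 r = (\<Union>i\<in>I. sphere 0 r \<union> O1 i)"
          using False by auto
        ultimately show ?thesis by simp
      qed
      ultimately show "connected (K1 \<inter> K2)" by simp
      have "ball 0 (min \<epsilon> s) \<subseteq> - K1"
        using \<epsilon> unfolding K1_def by auto
      then show "connected_component (- K1) y y'"
        using y y' connected_component_of_subset convex_connected[OF convex_ball]
        unfolding connected_component_def by blast
      show "connected_component (- K2) y y'"
        using yy' by (rule connected_component_of_subset) (auto simp: K2_def)
    qed
    then obtain T where T: "connected T" "T \<subseteq> - (K1 \<union> K2)" "y \<in> T" "y' \<in> T"
      unfolding connected_component_def by blast
    \<comment> \<open>The annulus keeps the connecting set inside the small disc.\<close>
    have "T \<inter> sphere 0 s = {}"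
      using T(2) sr by (auto simp: K1_def)
    then have "T \<subseteq> ball 0 s"
      using connected_Int_frontier[OF T(1), of "ball 0 s"] T(3) y s by force
    then show "connected_component (ball 0 s - Y) y y'"
      unfolding connected_component_def using T by (auto simp: K2_def)
  qed
qed

lemma Jordan_two_arcs:
  fixes c1 c2 :: "real \<Rightarrow> complex"
  assumes "arc c1" "arc c2" "pathstart c1 = a" "pathfinish c1 = b"
    "pathstart c2 = a" "pathfinish c2 = b" "path_image c1 \<inter> path_image c2 = {a, b}"
  shows "connected (inside (path_image c1 \<union> path_image c2))"
    and "closure (inside (path_image c1 \<union> path_image c2)) =
      inside (path_image c1 \<union> path_image c2) \<union> (path_image c1 \<union> path_image c2)"
proof -
  let ?c = "c1 +++ reversepath c2"
  have c: "simple_path ?c" "pathfinish ?c = pathstart ?c"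
    using assms by (auto simp: simple_path_join_loop_eq arc_reversepath)
  have im: "path_image ?c = path_image c1 \<union> path_image c2"
    using assms by (simp add: path_image_join)
  show "connected (inside (path_image c1 \<union> path_image c2))"
    and "closure (inside (path_image c1 \<union> path_image c2)) =
      inside (path_image c1 \<union> path_image c2) \<union> (path_image c1 \<union> path_image c2)"
    using Jordan_inside_outside[OF c] unfolding im
    by (auto simp: closure_Un_frontier)
qed

lemma crosscut_inside:
  fixes c1 c2 c :: "real \<Rightarrow> complex"
  assumes "arc c1" "arc c2" "arc c"
    and "pathstart c1 = a" "pathfinish c1 = b" "pathstart c2 = a" "pathfinish c2 = b"
    and "pathstart c = a" "pathfinish c = b"
    and "path_image c1 \<inter> path_image c2 = {a, b}" "path_image c1 \<inter> path_image c = {a, b}"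
      "path_image c2 \<inter> path_image c = {a, b}"
    and "path_image c \<inter> inside (path_image c1 \<union> path_image c2) \<noteq> {}"
  shows "inside (path_image c1 \<union> path_image c2) - path_image c =
      inside (path_image c1 \<union> path_image c) \<union> inside (path_image c2 \<union> path_image c)" (is ?split)
    and "inside (path_image c1 \<union> path_image c) \<inter> inside (path_image c2 \<union> path_image c) = {}" (is ?disj)
proof -
  have ab: "a \<noteq> b"
    using assms arc_distinct_ends by blast
  have d: "inside A \<inter> A = {}" for A :: "complex set"
    by simp
  have "?split \<and> ?disj"
  proof (rule split_inside_simple_closed_curve[of c1 a b c2 c])
    assume *: "inside (path_image c1 \<union> path_image c) \<inter> inside (path_image c2 \<union> path_image c) = {}"
      "inside (path_image c1 \<union> path_image c) \<union> inside (path_image c2 \<union> path_image c) \<union>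
           (path_image c - {a,b}) = inside(path_image c1 \<union> path_image c2)"
    show "?split \<and> ?disj"
      using * d[of "path_image c1 \<union> path_image c2"] d[of "path_image c1 \<union> path_image c"]
        d[of "path_image c2 \<union> path_image c"] assms(10,11) by blast
  qed (use assms ab in \<open>auto simp: arc_imp_simple_path\<close>)
  then show ?split ?disj by auto
qed

lemma circle_arcs:
  fixes p q :: complex
  assumes "p \<in> sphere 0 r" "q \<in> sphere 0 r" "p \<noteq> q" "0 < r"
  obtains u d where "arc u" "arc d" "pathstart u = p" "pathfinish u = q"
    "pathstart d = p" "pathfinish d = q"
    "path_image u \<inter> path_image d = {p, q}" "path_image u \<union> path_image d = sphere 0 r"
proof -
  have "simple_path (circlepath 0 r)" "pathfinish (circlepath 0 r) = pathstart (circlepath 0 r)"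
    "path_image (circlepath 0 r) = sphere 0 r"
    using assms by (auto simp: simple_path_circlepath)
  then obtain u d where "arc u" "arc d" "pathstart u = p" "pathfinish u = q"
    "pathstart d = q" "pathfinish d = p"
    "path_image u \<inter> path_image d = {p, q}" "path_image u \<union> path_image d = sphere 0 r"
    using exists_double_arc assms by metis
  then show ?thesis
    using that[of u "reversepath d"] by (simp add: arc_reversepath)
qed

text \<open>
  The two arcs of a circle between \<open>p\<close> and \<open>q\<close> are interchangeable, so \<open>d\<close> may be taken to be the one
  through a given third point.
\<close>

lemma circle_arcs_through:
  fixes p q x :: complex
  assumes pq: "p \<in> sphere 0 r" "q \<in> sphere 0 r" and x: "x \<in> sphere 0 r" and r: "0 < r" and ne: "p \<noteq> q"
  obtains u d where "arc u" "arc d" "pathstart u = p" "pathfinish u = q"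
    "pathstart d = p" "pathfinish d = q"
    "path_image u \<inter> path_image d = {p, q}" "path_image u \<union> path_image d = sphere 0 r"
    "x \<in> path_image d"
proof -
  obtain u d where ud: "arc u" "arc d" "pathstart u = p" "pathfinish u = q"
    "pathstart d = p" "pathfinish d = q"
    "path_image u \<inter> path_image d = {p, q}" "path_image u \<union> path_image d = sphere 0 r"
    by (rule circle_arcs[OF pq ne r])
  show ?thesis
  proof (cases "x \<in> path_image d")
    case True
    show ?thesis by (rule that[OF ud True])
  next
    case False
    then have "x \<in> path_image u" using x ud(8) by blast
    moreover have "path_image d \<inter> path_image u = {p, q}" "path_image d \<union> path_image u = sphere 0 r"
      using ud(7,8) by blast+
    ultimately show ?thesis
      by (rule that[OF ud(2,1,5,6,3,4), rotated 2])
  qed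
qed

lemma inside_circle:
  fixes r :: real
  shows "inside (sphere (0::complex) r) = ball 0 r"
proof (cases "r = 0")
  case False
  then show ?thesis
    using inside_frontier_eq_interior[of "cball (0::complex) r"] by (simp add: frontier_cball)
qed auto

definition leg :: "real \<Rightarrow> (real \<Rightarrow> complex) \<Rightarrow> bool" where
  "leg r \<gamma> \<longleftrightarrow> arc \<gamma> \<and> pathstart \<gamma> = 0 \<and> pathfinish \<gamma> \<in> sphere 0 r \<and>
    path_image \<gamma> \<subseteq> ball 0 r \<union> {pathfinish \<gamma>}"

lemma legs_distinct_ends:
  assumes "0 < r" "leg r \<gamma>" "path_image \<gamma> \<inter> path_image \<gamma>' = {0}"
  shows "pathfinish \<gamma> \<noteq> pathfinish \<gamma>'"
proof
  assume "pathfinish \<gamma> = pathfinish \<gamma>'"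
  then have "pathfinish \<gamma> = 0"
    using assms(3) by (metis IntI pathfinish_in_path_image singletonD)
  then show False using assms(1,2) by (auto simp: leg_def)
qed

lemma two_legs_arc:
  assumes "leg r \<gamma>" "leg r \<gamma>'" "path_image \<gamma> \<inter> path_image \<gamma>' = {0}"
  shows "arc (reversepath \<gamma> +++ \<gamma>')"
    and "path_image (reversepath \<gamma> +++ \<gamma>') = path_image \<gamma> \<union> path_image \<gamma>'"
  using assms unfolding leg_def by (auto simp: path_image_join arc_join arc_reversepath)

text \<open>
  Two legs form a crosscut of the disc.  The two sectors are the insides of the Jordan curves that
  the crosscut forms with either arc \<open>u\<close>, \<open>d\<close> of the circle.
\<close>

lemma two_legs_sectors:
  assumes r: "0 < r" and l: "leg r \<gamma>" "leg r \<gamma>'" "path_image \<gamma> \<inter> path_image \<gamma>' = {0}"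
    and u: "arc u" "pathstart u = pathfinish \<gamma>" "pathfinish u = pathfinish \<gamma>'"
    and d: "arc d" "pathstart d = pathfinish \<gamma>" "pathfinish d = pathfinish \<gamma>'"
    and ud: "path_image u \<inter> path_image d = {pathfinish \<gamma>, pathfinish \<gamma>'}"
      "path_image u \<union> path_image d = sphere 0 r"
  defines "Y \<equiv> path_image \<gamma> \<union> path_image \<gamma>'"
  shows "ball 0 r - Y = inside (path_image u \<union> Y) \<union> inside (path_image d \<union> Y)"
    and "inside (path_image u \<union> Y) \<inter> inside (path_image d \<union> Y) = {}"
    and "connected (inside (path_image u \<union> Y))" "connected (inside (path_image d \<union> Y))"
    and "closure (inside (path_image u \<union> Y)) = inside (path_image u \<union> Y) \<union> (path_image u \<union> Y)"
    and "closure (inside (path_image d \<union> Y)) = inside (path_image d \<union> Y) \<union> (path_image d \<union> Y)"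
proof -
  define c where "c = reversepath \<gamma> +++ \<gamma>'"
  have c: "arc c" "path_image c = Y" "pathstart c = pathfinish \<gamma>" "pathfinish c = pathfinish \<gamma>'"
    using two_legs_arc[OF l] by (auto simp: c_def Y_def)
  have ins: "inside (path_image u \<union> path_image d) = ball 0 r"
    unfolding ud by (rule inside_circle)
  have Y: "Y \<inter> sphere 0 r = {pathfinish \<gamma>, pathfinish \<gamma>'}"
    using l(1,2) by (auto simp: leg_def Y_def)
  have 0: "0 \<in> Y"
    using l(3) by (auto simp: Y_def)
  have uc: "path_image u \<inter> path_image c = {pathfinish \<gamma>, pathfinish \<gamma>'}"
    using Y ud c by blast
  have dc: "path_image d \<inter> path_image c = {pathfinish \<gamma>, pathfinish \<gamma>'}"
    using Y ud c by blast
  have "0 \<in> path_image c \<inter> inside (path_image u \<union> path_image d)"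
    using 0 r c ins by simp
  then have "path_image c \<inter> inside (path_image u \<union> path_image d) \<noteq> {}" by blast
  note ne = this
  from crosscut_inside(1)[OF u(1) d(1) c(1) u(2,3) d(2,3) c(3,4) ud(1) uc dc ne]
  show "ball 0 r - Y = inside (path_image u \<union> Y) \<union> inside (path_image d \<union> Y)"
    "inside (path_image u \<union> Y) \<inter> inside (path_image d \<union> Y) = {}"
    using crosscut_inside(2)[OF u(1) d(1) c(1) u(2,3) d(2,3) c(3,4) ud(1) uc dc ne]
    by (simp_all only: ins c)
  show "connected (inside (path_image u \<union> Y))" "connected (inside (path_image d \<union> Y))"
    "closure (inside (path_image u \<union> Y)) = inside (path_image u \<union> Y) \<union> (path_image u \<union> Y)"
    "closure (inside (path_image d \<union> Y)) = inside (path_image d \<union> Y) \<union> (path_image d \<union> Y)"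
    using Jordan_two_arcs[OF u(1) c(1) u(2,3) c(3,4) uc] Jordan_two_arcs[OF d(1) c(1) d(2,3) c(3,4) dc]
    by (simp_all add: c)
qed

lemma arc_split:
  fixes d :: "real \<Rightarrow> 'a::real_normed_vector"
  assumes "arc d" "p \<in> path_image d" "p \<noteq> pathstart d" "p \<noteq> pathfinish d"
  obtains d0 d1 where "arc d0" "arc d1" "pathstart d0 = pathstart d" "pathfinish d0 = p"
    "pathstart d1 = pathfinish d" "pathfinish d1 = p"
    "path_image d0 \<inter> path_image d1 = {p}" "path_image d0 \<union> path_image d1 = path_image d"
proof -
  obtain t where t: "t \<in> {0..1}" "d t = p"
    using assms(2) by (auto simp: path_image_def)
  have t01: "t \<noteq> 0" "t \<noteq> 1"
    using t assms(3,4) by (auto simp: pathstart_def pathfinish_def)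
  have inj: "inj_on d {0..1}"
    using assms(1) by (simp add: arc_def)
  have im: "path_image (subpath 0 t d) = d ` {0..t}" "path_image (subpath 1 t d) = d ` {t..1}"
    using t by (auto simp: path_image_subpath)
  show ?thesis
  proof
    show "arc (subpath 0 t d)" "arc (subpath 1 t d)"
      using assms(1) t t01 by (auto intro!: arc_subpath_arc)
    show "path_image (subpath 0 t d) \<union> path_image (subpath 1 t d) = path_image d"
    proof -
      have "{0..1} = {0..t} \<union> {t..1}"
        using t(1) by auto
      then show ?thesis
        unfolding im path_image_def[of d] by (simp add: image_Un)
    qed
    have "d ` {0..t} \<inter> d ` {t..1} = d ` ({0..t} \<inter> {t..1})"
      by (rule inj_on_image_Int[OF inj, symmetric]) (use t in auto)
    also have "{0..t} \<inter> {t..1} = {t}"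
      using t by auto
    finally show "path_image (subpath 0 t d) \<inter> path_image (subpath 1 t d) = {p}"
      using im t by simp
  qed (use t in \<open>auto simp: pathstart_def pathfinish_def subpath_def\<close>)
qed

lemma arc_interior:
  fixes g :: "real \<Rightarrow> 'a::t2_space"
  assumes arc: "arc g"
  defines "E \<equiv> path_image g - {pathstart g, pathfinish g}"
  shows "connected E" "E \<noteq> {}" "path_image g \<subseteq> closure E"
proof -
  have im: "E = g ` {0<..<1}"
  proof -
    have "inj_on g {0..1}" using arc by (simp add: arc_def)
    then have "g ` ({0..1} - {0, 1}) = g ` {0..1} - g ` {0, 1}"
      by (rule inj_on_image_set_diff) auto
    moreover have "{0..1} - {0, 1} = {0<..<1::real}" by auto
    ultimately show ?thesis
      by (simp add: E_def path_image_def pathstart_def pathfinish_def)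
  qed
  have cont: "continuous_on {0..1} g"
    using arc by (simp add: arc_def path_def)
  show "connected E"
    unfolding im by (intro connected_continuous_image continuous_on_subset[OF cont]) auto
  show "E \<noteq> {}"
    unfolding im by auto
  have "g ` closure {0<..<1} \<subseteq> closure (g ` {0<..<1})"
    by (rule image_closure_subset[OF _ closed_closure closure_subset]) (use cont in auto)
  then show "path_image g \<subseteq> closure E"
    unfolding im by (simp add: path_image_def)
qed

text \<open>
  The legs \<open>g0\<close> and \<open>g1\<close> cut the disc into \<open>C\<close> and \<open>W\<close>, where \<open>W\<close> is the one whose circular arc \<open>d\<close>
  contains the end of \<open>g2\<close>.  The third leg must run in \<open>W\<close>, because its end is not in the closure of
  \<open>C\<close>; it is a crosscut of \<open>W\<close> from the centre to the circle, and cuts it into \<open>A\<close> and \<open>B\<close>.  The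
  sectors \<open>A\<close>, \<open>B\<close>, \<open>C\<close> are opposite to \<open>g0\<close>, \<open>g1\<close>, \<open>g2\<close>.
\<close>

lemma three_legs_sectors:
  assumes r: "0 < r" and l: "leg r g0" "leg r g1" "leg r g2"
    and int: "path_image g0 \<inter> path_image g1 = {0}" "path_image g0 \<inter> path_image g2 = {0}"
      "path_image g1 \<inter> path_image g2 = {0}"
  obtains A B C D0 D1 D2 where
    "ball 0 r - (path_image g0 \<union> path_image g1 \<union> path_image g2) = A \<union> B \<union> C"
    "connected A" "connected B" "connected C"
    "D0 \<union> D1 \<union> D2 \<subseteq> sphere 0 r"
    "closure A = A \<union> (path_image g1 \<union> path_image g2 \<union> D0)"
    "closure B = B \<union> (path_image g0 \<union> path_image g2 \<union> D1)"
    "closure C = C \<union> (path_image g0 \<union> path_image g1 \<union> D2)"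
proof -
  let ?p0 = "pathfinish g0" and ?p1 = "pathfinish g1" and ?p2 = "pathfinish g2"
  have sph: "path_image g0 \<inter> sphere 0 r = {?p0}" "path_image g1 \<inter> sphere 0 r = {?p1}"
    "path_image g2 \<inter> sphere 0 r = {?p2}"
    using l by (auto simp: leg_def)
  have p: "?p0 \<noteq> ?p1" "?p0 \<noteq> ?p2" "?p1 \<noteq> ?p2"
    using legs_distinct_ends[OF r l(1) int(1)] legs_distinct_ends[OF r l(1) int(2)]
      legs_distinct_ends[OF r l(2) int(3)] by simp_all
  have psph: "?p0 \<in> sphere 0 r" "?p1 \<in> sphere 0 r" "?p2 \<in> sphere 0 r" "0 < r"
    using sph r by auto
  obtain u d where arcs: "arc u" "arc d" and se: "pathstart u = ?p0" "pathfinish u = ?p1"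
    "pathstart d = ?p0" "pathfinish d = ?p1"
    and ud: "path_image u \<inter> path_image d = {?p0, ?p1}" "path_image u \<union> path_image d = sphere 0 r"
    and p2d: "?p2 \<in> path_image d"
    by (rule circle_arcs_through[OF psph p(1)])
  define Y where "Y = path_image g0 \<union> path_image g1"
  define C where "C = inside (path_image u \<union> Y)"
  define W where "W = inside (path_image d \<union> Y)"
  note two = two_legs_sectors[OF r l(1,2) int(1) arcs(1) se(1,2) arcs(2) se(3,4) ud,
      folded Y_def, folded C_def W_def]
  have cl: "closed Y" "closed (path_image u)" "closed (path_image d)"
    using l arcs unfolding Y_def leg_def
    by (auto intro!: closed_Un simp: closed_arc_image)
  have op: "open C" "open W"
    unfolding C_def W_def using cl by (auto intro!: open_inside closed_Un)
  define h where "h = path_image g2 - {0, ?p2}"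
  have arc2: "arc g2" "pathstart g2 = 0"
    using l(3) by (simp_all add: leg_def)
  have hne: "h \<noteq> {}" and hcon: "connected h" and hcl: "?p2 \<in> closure h"
    using arc_interior[OF arc2(1)] arc2(2) pathfinish_in_path_image[of g2] unfolding h_def by auto
  have h: "h \<subseteq> ball 0 r - Y"
    using l(3) int(2,3) by (auto simp: h_def leg_def Y_def)
  have "\<not> h \<subseteq> C"
  proof
    assume "h \<subseteq> C"
    then have "?p2 \<in> closure C"
      using hcl closure_mono by blast
    moreover have "?p2 \<notin> C"
      using two(1) l(3) by (auto simp: leg_def)
    moreover have "?p2 \<notin> Y"
    proof
      assume "?p2 \<in> Y"
      then have "?p2 \<in> path_image g0 \<inter> sphere 0 r \<or> ?p2 \<in> path_image g1 \<inter> sphere 0 r"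
        using psph(3) unfolding Y_def by blast
      then show False
        unfolding sph using p by auto
    qed
    moreover have "?p2 \<notin> path_image u"
    proof
      assume "?p2 \<in> path_image u"
      then have "?p2 \<in> path_image u \<inter> path_image d"
        using p2d by blast
      then show False
        unfolding ud(1) using p by auto
    qed
    ultimately show False
      unfolding two(5) by blast
  qed
  then have hW: "h \<subseteq> W"
    using connectedD[OF hcon op] h two(1,2) by blast
  have gC: "path_image g2 \<inter> C = {}"
  proof -
    have "path_image g2 \<subseteq> h \<union> {0, ?p2}" by (auto simp: h_def)
    moreover have "0 \<notin> C"
      using two(1) int(1) by (auto simp: Y_def)
    moreover have "?p2 \<notin> C"
      using two(1) l(3) by (auto simp: leg_def)
    ultimately show ?thesis using hW two(2) by blast
  qed
  obtain d0 d1 where d: "arc d0" "arc d1" "pathstart d0 = ?p0" "pathfinish d0 = ?p2"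
    "pathstart d1 = ?p1" "pathfinish d1 = ?p2"
    "path_image d0 \<inter> path_image d1 = {?p2}" "path_image d0 \<union> path_image d1 = path_image d"
    by (rule arc_split[OF arcs(2) p2d, unfolded se, OF p(2,3)[symmetric]])
  have dsph: "path_image d0 \<subseteq> sphere 0 r" "path_image d1 \<subseteq> sphere 0 r"
    unfolding ud(2)[symmetric] d(8)[symmetric] by blast+
  have pd: "?p0 \<in> path_image d0" "?p2 \<in> path_image d0" "?p1 \<in> path_image d1" "?p2 \<in> path_image d1"
    using pathstart_in_path_image[of d0] pathfinish_in_path_image[of d0]
      pathstart_in_path_image[of d1] pathfinish_in_path_image[of d1] d(3-6) by simp_all
  have pnd: "?p0 \<notin> path_image d1" "?p1 \<notin> path_image d0"
  proof -
    have "x \<in> {?p2}" if "x \<in> path_image d0" "x \<in> path_image d1" for x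
      unfolding d(7)[symmetric] using that by blast
    then show "?p0 \<notin> path_image d1" "?p1 \<notin> path_image d0"
      using pd(1,3) p by auto
  qed
  have zero: "pathstart g0 = 0" "pathstart g1 = 0" "pathstart g2 = 0"
    "arc g0" "arc g1" "arc g2"
    using l by (simp_all add: leg_def)
  \<comment> \<open>The boundary of \<open>W\<close>, divided at the two ends of \<open>g2\<close>.\<close>
  define c1 where "c1 = g0 +++ d0"
  define c2 where "c2 = g1 +++ d1"
  have im1: "path_image c1 = path_image g0 \<union> path_image d0"
    and im2: "path_image c2 = path_image g1 \<union> path_image d1"
    unfolding c1_def c2_def using d(3,5) by (simp_all add: path_image_join)
  have "path_image g0 \<inter> path_image d0 \<subseteq> {?p0}" "path_image g1 \<inter> path_image d1 \<subseteq> {?p1}"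
    using sph(1,2) dsph by blast+
  then have arcs': "arc c1" "arc c2"
    using zero(4,5) d(1-3,5) unfolding c1_def c2_def by (simp_all add: arc_join)
  have ends: "pathstart c1 = 0" "pathfinish c1 = ?p2" "pathstart c2 = 0" "pathfinish c2 = ?p2"
    using d(4,6) zero by (simp_all add: c1_def c2_def)
  have 0: "0 \<in> path_image g0" "0 \<in> path_image g1" "0 \<in> path_image g2" "?p2 \<in> path_image g2"
    using int pathfinish_in_path_image[of g2] by blast+
  have gd: "path_image g0 \<inter> path_image d1 = {}" "path_image d0 \<inter> path_image g1 = {}"
  proof -
    have meet: "M \<inter> Y' = {}" if "M \<inter> S = {x}" "Y' \<subseteq> S" "x \<notin> Y'"
      for M Y' S :: "complex set" and x
      using equalityD1[OF that(1)] that(2,3) by blast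
    show "path_image g0 \<inter> path_image d1 = {}"
      by (rule meet[OF sph(1) dsph(2) pnd(1)])
    show "path_image d0 \<inter> path_image g1 = {}"
      using meet[OF sph(2) dsph(1) pnd(2)] by (simp only: Int_commute)
  qed
  have gd2: "path_image d0 \<inter> path_image g2 = {?p2}" "path_image d1 \<inter> path_image g2 = {?p2}"
  proof -
    have meet: "Y' \<inter> M = {x}" if "M \<inter> S = {x}" "Y' \<subseteq> S" "x \<in> Y'" for M Y' S :: "complex set" and x
      using equalityD1[OF that(1)] equalityD2[OF that(1)] that(2,3) by blast
    show "path_image d0 \<inter> path_image g2 = {?p2}" "path_image d1 \<inter> path_image g2 = {?p2}"
      by (rule meet[OF sph(3) dsph(1) pd(2)], rule meet[OF sph(3) dsph(2) pd(4)])
  qed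
  have c12: "path_image c1 \<inter> path_image c2 = {0, ?p2}"
    unfolding im1 im2 Int_Un_distrib Int_Un_distrib2 int d(7) gd by auto
  have c1g: "path_image c1 \<inter> path_image g2 = {0, ?p2}"
    unfolding im1 Int_Un_distrib2 int gd2 by auto
  have c2g: "path_image c2 \<inter> path_image g2 = {0, ?p2}"
    unfolding im2 Int_Un_distrib2 int gd2 by auto
  have im12: "path_image c1 \<union> path_image c2 = path_image d \<union> Y"
    unfolding im1 im2 Y_def d(8)[symmetric] by auto
  have ne: "path_image g2 \<inter> inside (path_image c1 \<union> path_image c2) \<noteq> {}"
  proof -
    have "h \<subseteq> path_image g2" by (auto simp: h_def)
    with hW hne show ?thesis unfolding im12 W_def[symmetric] by blast
  qed
  define B where "B = inside (path_image c1 \<union> path_image g2)"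
  define A where "A = inside (path_image c2 \<union> path_image g2)"
  have split: "W - path_image g2 = B \<union> A"
    using crosscut_inside(1)[OF arcs' zero(6) ends zero(3) refl c12 c1g c2g ne]
    unfolding im12 W_def[symmetric] A_def[symmetric] B_def[symmetric] .
  show ?thesis
  proof (rule that[of A B C "path_image d1" "path_image d0" "path_image u"])
    show "ball 0 r - (path_image g0 \<union> path_image g1 \<union> path_image g2) = A \<union> B \<union> C"
      using two(1) split gC unfolding Y_def[symmetric] by blast
    show "connected A" "connected B" "connected C"
      using Jordan_two_arcs(1)[OF arcs'(1) zero(6) ends(1,2) zero(3) refl c1g]
        Jordan_two_arcs(1)[OF arcs'(2) zero(6) ends(3,4) zero(3) refl c2g] two(3)
      by (auto simp: A_def B_def)
    show "path_image d1 \<union> path_image d0 \<union> path_image u \<subseteq> sphere 0 r"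
      using dsph ud(2) by blast
    show "closure A = A \<union> (path_image g1 \<union> path_image g2 \<union> path_image d1)"
      using Jordan_two_arcs(2)[OF arcs'(2) zero(6) ends(3,4) zero(3) refl c2g]
      unfolding A_def im2 by (simp only: Un_ac)
    show "closure B = B \<union> (path_image g0 \<union> path_image g2 \<union> path_image d0)"
      using Jordan_two_arcs(2)[OF arcs'(1) zero(6) ends(1,2) zero(3) refl c1g]
      unfolding B_def im1 by (simp only: Un_ac)
    show "closure C = C \<union> (path_image g0 \<union> path_image g1 \<union> path_image u)"
      using two(5) unfolding Y_def by (simp only: Un_ac)
  qed
qed

text \<open>
  Leg \<open>i\<close> borders sector \<open>j\<close> iff \<open>i \<noteq> j\<close>.  For three legs, sector \<open>j\<close> is the one opposite to leg \<open>j\<close>.  For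
  two legs, both of them border both sectors, so the sectors get numbers that no leg has.
\<close>

definition leg_pattern :: "nat set \<Rightarrow> nat set \<Rightarrow> bool" where
  "leg_pattern I J \<longleftrightarrow> I = {0, 1} \<and> J = {2, 3} \<or> I = {0, 1, 2} \<and> J = {0, 1, 2}"

lemma plane_sectors:
  assumes pat: "leg_pattern I J" and r: "0 < r"
    and l: "\<And>i. i \<in> I \<Longrightarrow> leg r (\<gamma> i)"
    and int: "\<And>i j. \<lbrakk>i \<in> I; j \<in> I; i \<noteq> j\<rbrakk> \<Longrightarrow> path_image (\<gamma> i) \<inter> path_image (\<gamma> j) = {0}"
  shows "\<exists>U. ball 0 r - (\<Union>i\<in>I. path_image (\<gamma> i)) = (\<Union>j\<in>J. U j) \<and>
    (\<forall>j\<in>J. connected (U j)) \<and>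
    (\<forall>i\<in>I. \<forall>j\<in>J. i \<noteq> j \<longrightarrow> path_image (\<gamma> i) \<subseteq> closure (U j)) \<and>
    (\<forall>i\<in>I \<inter> J. path_image (\<gamma> i) \<inter> closure (U i) \<inter> ball 0 r \<subseteq> {0})"
  using pat unfolding leg_pattern_def
proof (elim disjE conjE)
  assume I: "I = {0, 1}" and J: "J = {2, 3}"
  have l: "leg r (\<gamma> 0)" "leg r (\<gamma> 1)" and int: "path_image (\<gamma> 0) \<inter> path_image (\<gamma> 1) = {0}"
    using l int by (auto simp: I)
  have "pathfinish (\<gamma> 0) \<noteq> pathfinish (\<gamma> 1)"
    using legs_distinct_ends[OF r l(1) int] .
  moreover have "pathfinish (\<gamma> 0) \<in> sphere 0 r" "pathfinish (\<gamma> 1) \<in> sphere 0 r"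
    using l by (simp_all add: leg_def)
  ultimately obtain u d where ud: "arc u" "pathstart u = pathfinish (\<gamma> 0)" "pathfinish u = pathfinish (\<gamma> 1)"
    "arc d" "pathstart d = pathfinish (\<gamma> 0)" "pathfinish d = pathfinish (\<gamma> 1)"
    "path_image u \<inter> path_image d = {pathfinish (\<gamma> 0), pathfinish (\<gamma> 1)}"
    "path_image u \<union> path_image d = sphere 0 r"
    using circle_arcs[of "pathfinish (\<gamma> 0)" r "pathfinish (\<gamma> 1)"] r
    by metis
  define Y where "Y = path_image (\<gamma> 0) \<union> path_image (\<gamma> 1)"
  note two = two_legs_sectors[OF r l int ud, folded Y_def]
  show ?thesis
  proof (intro exI[of _ "\<lambda>j. if j = 2 then inside (path_image u \<union> Y) else inside (path_image d \<union> Y)"] conjI ballI impI)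
    show "ball 0 r - (\<Union>i\<in>I. path_image (\<gamma> i)) =
      (\<Union>j\<in>J. if j = 2 then inside (path_image u \<union> Y) else inside (path_image d \<union> Y))"
    proof -
      have "(\<Union>i\<in>I. path_image (\<gamma> i)) = Y"
        by (simp add: I Y_def)
      then show ?thesis
        unfolding J using two(1) by auto
    qed
    show "connected (if j = 2 then inside (path_image u \<union> Y) else inside (path_image d \<union> Y))" for j
      using two by simp
    show "path_image (\<gamma> i) \<subseteq> closure (if j = 2 then inside (path_image u \<union> Y) else inside (path_image d \<union> Y))"
      if "i \<in> I" for i j
      using that two(5,6) by (auto simp: I Y_def)
  qed (auto simp: I J)
next
  assume I: "I = {0, 1, 2}" and J: "J = {0, 1, 2}"
  let ?g0 = "path_image (\<gamma> 0)" and ?g1 = "path_image (\<gamma> 1)" and ?g2 = "path_image (\<gamma> 2)"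
  have l: "leg r (\<gamma> 0)" "leg r (\<gamma> 1)" "leg r (\<gamma> 2)"
    and int: "?g0 \<inter> ?g1 = {0}" "?g0 \<inter> ?g2 = {0}" "?g1 \<inter> ?g2 = {0}"
    using l int by (auto simp: I)
  obtain A B C D0 D1 D2 where
    s: "ball 0 r - (?g0 \<union> ?g1 \<union> ?g2) = A \<union> B \<union> C"
    "connected A" "connected B" "connected C"
    "D0 \<union> D1 \<union> D2 \<subseteq> sphere 0 r"
    "closure A = A \<union> (?g1 \<union> ?g2 \<union> D0)"
    "closure B = B \<union> (?g0 \<union> ?g2 \<union> D1)"
    "closure C = C \<union> (?g0 \<union> ?g1 \<union> D2)"
    by (rule three_legs_sectors[OF r l int])
  have D: "D0 \<inter> ball 0 r = {}" "D1 \<inter> ball 0 r = {}" "D2 \<inter> ball 0 r = {}"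
    using s(5) by auto
  define U where "U = (\<lambda>j::nat. if j = 0 then A else if j = 1 then B else C)"
  have U: "U 0 = A" "U 1 = B" "U (Suc 0) = B" "U 2 = C"
    by (auto simp: U_def)
  show ?thesis
  proof (intro exI[of _ U] conjI ballI impI)
    show "ball 0 r - (\<Union>i\<in>I. path_image (\<gamma> i)) = (\<Union>j\<in>J. U j)"
      using s(1) by (simp add: I J U Un_assoc)
    show "connected (U j)" if "j \<in> J" for j
      using that s(2-4) by (auto simp: J U)
    show "path_image (\<gamma> i) \<subseteq> closure (U j)" if "i \<in> I" "j \<in> J" "i \<noteq> j" for i j
      using that s(6-8) by (auto simp: I J U)
    have "?g0 \<inter> closure A \<inter> ball 0 r \<subseteq> {0}" "?g1 \<inter> closure B \<inter> ball 0 r \<subseteq> {0}"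
      "?g2 \<inter> closure C \<inter> ball 0 r \<subseteq> {0}"
    proof -
      have "A \<inter> ?g0 = {}" "B \<inter> ?g1 = {}" "C \<inter> ?g2 = {}"
        using s(1) by blast+
      moreover have "M \<inter> (A' \<union> (X1 \<union> X2 \<union> D')) \<inter> Z \<subseteq> {0}"
        if "A' \<inter> M = {}" "M \<inter> X1 = {0}" "M \<inter> X2 = {0}" "D' \<inter> Z = {}"
        for M A' X1 X2 D' Z :: "complex set"
        using that by blast
      ultimately show "?g0 \<inter> closure A \<inter> ball 0 r \<subseteq> {0}" "?g1 \<inter> closure B \<inter> ball 0 r \<subseteq> {0}"
        "?g2 \<inter> closure C \<inter> ball 0 r \<subseteq> {0}"
        using D int unfolding s(6-8) by (simp_all only: Int_commute)
    qed
    then show "path_image (\<gamma> i) \<inter> closure (U i) \<inter> ball 0 r \<subseteq> {0}" if "i \<in> I \<inter> J" for i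
      using that by (auto simp: I U)
  qed
qed

section \<open>Arcs from a point of the sphere\<close>

lemma sphere_chart:
  fixes x :: "real^3"
  assumes x: "x \<in> sphere 0 1"
  obtains f :: "real^3 \<Rightarrow> complex" and h b
  where "homeomorphism (sphere 0 1 - {b}) UNIV f h" "h 0 = x" "f x = 0" "b \<noteq> x"
proof -
  have x0: "x \<noteq> 0"
    using x by auto
  then have b: "- x \<in> sphere 0 1" "- x \<noteq> x"
    using x by (auto simp: vec_eq_iff)
  have "sphere 0 1 - {- x} homeomorphic {y :: real^3. x \<bullet> y = 0}"
    by (rule homeomorphic_punctured_sphere_hyperplane) (use x b in auto)
  also have "{y :: real^3. x \<bullet> y = 0} homeomorphic (UNIV :: complex set)"
    by (rule homeomorphic_affine_sets) (use x0 in \<open>auto simp: affine_hyperplane\<close>)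
  finally obtain f h where fh: "homeomorphism (sphere 0 1 - {- x}) (UNIV :: complex set) f h"
    by (auto simp: homeomorphic_def)
  define f' where "f' = (\<lambda>y. f y - f x)"
  define h' where "h' = (\<lambda>z. h (z + f x))"
  have "homeomorphism (sphere 0 1 - {- x}) UNIV f' h'"
  proof (rule homeomorphismI)
    have "continuous_on UNIV h" using fh by (simp add: homeomorphism_def)
    then show "continuous_on UNIV h'"
      unfolding h'_def by (rule continuous_on_compose2) (auto intro: continuous_intros)
    show "continuous_on (sphere 0 1 - {- x}) f'"
      unfolding f'_def using fh by (intro continuous_intros) (simp add: homeomorphism_def)
    show "h' ` UNIV \<subseteq> sphere 0 1 - {- x}"
      using fh unfolding h'_def homeomorphism_def by blast
    show "h' (f' y) = y" if "y \<in> sphere 0 1 - {- x}" for y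
      using fh that by (simp add: h'_def f'_def homeomorphism_def)
    show "f' (h' z) = z" for z
      using fh by (simp add: h'_def f'_def homeomorphism_def)
  qed auto
  moreover have "h' 0 = x"
    using fh x b by (simp add: h'_def homeomorphism_def)
  ultimately show ?thesis
    using that[of "-x" f' h'] b by (simp add: f'_def)
qed

text \<open>
  The local picture at a point \<open>x\<close> of the sphere from which two or three arcs start: near \<open>x\<close>, the
  complement of the graph consists of the sectors between the arcs, each sector lies in one face,
  and of the arcs exactly the two adjacent ones are in its closure.

  In a chart around \<open>x\<close>, cut each arc at its first exit of a small disc to obtain legs, and divide the
  disc into sectors.  A sector may be cut again by the rest of the graph, and by later returns of the
  arcs.  But these stay away from \<open>x\<close>, and nearby points of one sector are connected without
  going far from \<open>x\<close>.
\<close>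

lemma germ_sectors:
  fixes g :: "nat \<Rightarrow> real \<Rightarrow> real^3"
  assumes pat: "leg_pattern I J" and x: "x \<in> sphere 0 1"
    and arc: "\<And>i. i \<in> I \<Longrightarrow> arc (g i)" and start: "\<And>i. i \<in> I \<Longrightarrow> pathstart (g i) = x"
    and sph: "\<And>i. i \<in> I \<Longrightarrow> path_image (g i) \<subseteq> sphere 0 1"
    and int: "\<forall>i\<in>I. \<forall>j\<in>I. i \<noteq> j \<longrightarrow> path_image (g i) \<inter> path_image (g j) = {x}"
    and R: "closed R" "x \<notin> R"
  defines "\<Gamma> \<equiv> R \<union> (\<Union>i\<in>I. path_image (g i))"
  shows "\<exists>N V. openin (top_of_set (sphere 0 1)) N \<and> x \<in> N \<and> N - \<Gamma> \<subseteq> (\<Union>j\<in>J. V j) \<and>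
    (\<forall>j\<in>J. \<exists>a\<in>components (sphere 0 1 - \<Gamma>). V j \<subseteq> a) \<and>
    (\<forall>i\<in>I. \<forall>j\<in>J. i \<noteq> j \<longrightarrow> path_image (g i) \<inter> N \<subseteq> closure (V j)) \<and>
    (\<forall>i\<in>I \<inter> J. path_image (g i) \<inter> N \<inter> closure (V i) \<subseteq> {x})"
proof -
  have finI: "finite I" using pat by (auto simp: leg_pattern_def)
  obtain f :: "real^3 \<Rightarrow> complex" and h b
    where fh: "homeomorphism (sphere 0 1 - {b}) UNIV f h" and h0: "h 0 = x" and fx: "f x = 0"
      and bx: "b \<noteq> x"
    by (rule sphere_chart[OF x])
  have conth: "continuous_on A h" for A
    using fh by (auto simp: homeomorphism_def intro: continuous_on_subset)
  have hf: "h (f y) = y" if "y \<in> sphere 0 1" "y \<noteq> b" for y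
    using fh that by (simp add: homeomorphism_def)
  have fh_id [simp]: "f (h z) = z" for z
    using fh by (simp add: homeomorphism_def)
  have h_sph: "h z \<in> sphere 0 1" "h z \<noteq> b" for z
    using fh unfolding homeomorphism_def by blast+
  have h_inj: "h z = h w \<longleftrightarrow> z = w" for z w
    by (metis fh_id)
  have h_image: "y \<in> h ` A \<longleftrightarrow> y \<in> sphere 0 1 \<and> y \<noteq> b \<and> f y \<in> A" for y A
    using hf h_sph by (metis fh_id image_iff)
  have h_open: "openin (top_of_set (sphere 0 1)) (h ` A)" if "open A" for A
  proof -
    have "openin (top_of_set (sphere 0 1 - {b})) (h ` A)"
      using homeomorphism_imp_open_map[OF homeomorphism_symD[OF fh], of A] that by simp
    moreover have "openin (top_of_set (sphere 0 1)) (sphere 0 1 - {b})"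
      by (simp add: openin_delete)
    ultimately show ?thesis by (rule openin_trans)
  qed
  have near: "\<exists>r>0. h ` ball 0 r \<inter> F = {}" if "closed F" "x \<notin> F" for F
  proof -
    have "open (h -` (- F))"
      using conth[of UNIV] that(1) by (simp add: continuous_on_open_vimage open_Compl)
    moreover have "0 \<in> h -` (- F)" using h0 that(2) by simp
    ultimately obtain r where "0 < r" "ball 0 r \<subseteq> h -` (- F)"
      by (meson open_contains_ball)
    then show ?thesis by blast
  qed
  have g1: "g i 1 \<noteq> x" if "i \<in> I" for i
    using arc_distinct_ends[OF arc[OF that]] start[OF that] by (auto simp: pathfinish_def)
  \<comment> \<open>The disc must be so small that every arc ends outside.\<close>
  obtain r where r: "0 < r" "h ` ball 0 r \<inter> (\<lambda>i. g i 1) ` I = {}"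
    using near[of "(\<lambda>i. g i 1) ` I"] finI g1 by (auto simp: finite_imp_closed)
  obtain W where W: "open W" "h ` ball 0 r = sphere 0 1 \<inter> W"
    using h_open[of "ball 0 r"] by (auto simp: openin_open)
  have gs: "g i u \<in> sphere 0 1" if "i \<in> I" "0 \<le> u" "u \<le> 1" for i u
    using sph[OF that(1)] that(2,3) unfolding path_image_def by (meson atLeastAtMost_iff image_subset_iff)
  have gc: "continuous_on {0..1} (g i)" if "i \<in> I" for i
    using arc[OF that] by (simp add: arc_def path_def)
  have "\<exists>t. 0 < t \<and> t \<le> 1 \<and> g i t \<notin> h ` ball 0 r \<and> (\<forall>u. 0 \<le> u \<longrightarrow> u < t \<longrightarrow> g i u \<in> h ` ball 0 r)"
    if i: "i \<in> I" for i
  proof -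
    obtain t where t: "0 \<le> t" "t \<le> 1" "g i t \<in> - W" "\<And>u. \<lbrakk>0 \<le> u; u < t\<rbrakk> \<Longrightarrow> g i u \<notin> - W"
    proof (rule first_hit[OF gc[OF i]])
      show "closed (- W)" using W(1) by (simp add: closed_def)
      have "g i 1 \<notin> sphere 0 1 \<inter> W"
        using r(2) i unfolding W(2) by blast
      then show "g i 1 \<in> - W"
        using gs[OF i, of 1] by simp
    qed auto
    have "x \<in> h ` ball 0 r" using r h0 by force
    then have "t \<noteq> 0"
      using t(3) start[OF i] unfolding W(2) by (auto simp: pathstart_def)
    then show ?thesis
      using t gs[OF i] unfolding W(2) by (intro exI[of _ t]) auto
  qed
  then obtain t where t: "\<And>i. i \<in> I \<Longrightarrow> 0 < t i" "\<And>i. i \<in> I \<Longrightarrow> t i \<le> 1"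
    "\<And>i. i \<in> I \<Longrightarrow> g i (t i) \<notin> h ` ball 0 r"
    "\<And>i u. \<lbrakk>i \<in> I; 0 \<le> u; u < t i\<rbrakk> \<Longrightarrow> g i u \<in> h ` ball 0 r"
    by metis
  have t_cball: "g i u \<in> h ` cball 0 r" if i: "i \<in> I" and u: "0 \<le> u" "u \<le> t i" for i u
  proof -
    have "closed (h ` cball 0 r)"
      by (intro compact_imp_closed compact_continuous_image conth) auto
    moreover have "g i ` closure {0..<t i} \<subseteq> closure (h ` ball 0 r)"
    proof (rule image_closure_subset[OF _ closed_closure])
      show "continuous_on (closure {0..<t i}) (g i)"
        using t(1,2)[OF i] by (intro continuous_on_subset[OF gc[OF i]]) auto
      show "g i ` {0..<t i} \<subseteq> closure (h ` ball 0 r)"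
        using t(4)[OF i] closure_subset by fastforce
    qed
    moreover have "closure (h ` ball 0 r) \<subseteq> closure (h ` cball 0 r)"
      by (intro closure_mono image_mono) auto
    moreover have "u \<in> closure {0..<t i}"
      using u t(1)[OF i] by simp
    ultimately show ?thesis by (metis closure_closed image_subset_iff subset_iff)
  qed
  define \<gamma> where "\<gamma> = (\<lambda>i. f \<circ> subpath 0 (t i) (g i))"
  have \<gamma>_im: "path_image (\<gamma> i) = f ` g i ` {0..t i}" if "i \<in> I" for i
    using t(1)[OF that] by (simp add: \<gamma>_def path_image_compose path_image_subpath)
  have h\<gamma>: "h z \<in> path_image (g i)" if i: "i \<in> I" and z: "z \<in> path_image (\<gamma> i)" for i z
  proof -
    obtain u where u: "0 \<le> u" "u \<le> t i" "z = f (g i u)"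
      using z unfolding \<gamma>_im[OF i] by auto
    then have "h z = g i u"
      using t_cball[OF i u(1,2)] unfolding h_image by (simp add: hf)
    then show ?thesis
      using u t(2)[OF i] by (auto simp: path_image_def)
  qed
  have leg: "leg r (\<gamma> i)" if i: "i \<in> I" for i
  proof -
    have sub: "path_image (subpath 0 (t i) (g i)) \<subseteq> sphere 0 1 - {b}"
    proof -
      have "g i u \<in> sphere 0 1 - {b}" if "u \<in> {0..t i}" for u
        using t_cball[OF i, of u] that unfolding h_image by simp
      then have "g i ` {0..t i} \<subseteq> sphere 0 1 - {b}"
        by (rule image_subsetI)
      then show ?thesis
        using t(1)[OF i] by (simp only: path_image_subpath less_imp_le if_True)
    qed
    have "arc (subpath 0 (t i) (g i))"
      using arc[OF i] t(1,2)[OF i] by (intro arc_subpath_arc) auto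
    moreover have "continuous_on (path_image (subpath 0 (t i) (g i))) f"
      using fh sub by (auto simp: homeomorphism_def intro: continuous_on_subset)
    moreover have "inj_on f (path_image (subpath 0 (t i) (g i)))"
    proof (rule inj_on_inverseI)
      show "h (f y) = y" if "y \<in> path_image (subpath 0 (t i) (g i))" for y
        using subsetD[OF sub that] hf[of y] by blast
    qed
    ultimately have 1: "arc (\<gamma> i)"
      unfolding \<gamma>_def by (simp add: arc_def path_continuous_image comp_inj_on path_image_def)
    have 2: "pathstart (\<gamma> i) = 0"
      using start[OF i] fx by (simp add: \<gamma>_def pathstart_compose) (simp add: pathstart_def)
    have fin: "pathfinish (\<gamma> i) = f (g i (t i))"
      by (simp add: \<gamma>_def pathfinish_compose)
    have 3: "pathfinish (\<gamma> i) \<in> sphere 0 r"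
      using t_cball[OF i, of "t i"] t(1,3)[OF i] unfolding h_image fin by auto
    have "f (g i u) \<in> ball 0 r" if "0 \<le> u" "u < t i" for u
      using t(4)[OF i that] unfolding h_image by simp
    then have 4: "path_image (\<gamma> i) \<subseteq> ball 0 r \<union> {pathfinish (\<gamma> i)}"
      unfolding \<gamma>_im[OF i] fin by (force simp: less_le)
    show ?thesis using 1 2 3 4 by (simp add: leg_def)
  qed
  have \<gamma>int: "path_image (\<gamma> i) \<inter> path_image (\<gamma> j) = {0}" if ij: "i \<in> I" "j \<in> I" "i \<noteq> j" for i j
  proof -
    have "z = 0" if z: "z \<in> path_image (\<gamma> i)" "z \<in> path_image (\<gamma> j)" for z
    proof -
      have "h z \<in> path_image (g i) \<inter> path_image (g j)"
        using h\<gamma>[OF ij(1) z(1)] h\<gamma>[OF ij(2) z(2)] by blast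
      then show ?thesis
        using int ij h0 h_inj[of z 0] by simp
    qed
    moreover have "0 \<in> path_image (\<gamma> i)" "0 \<in> path_image (\<gamma> j)"
      using leg[OF ij(1)] leg[OF ij(2)] pathstart_in_path_image unfolding leg_def by metis+
    ultimately show ?thesis by blast
  qed
  define Y where "Y = (\<Union>i\<in>I. path_image (\<gamma> i))"
  obtain U where "ball 0 r - Y = (\<Union>j\<in>J. U j) \<and> (\<forall>j\<in>J. connected (U j)) \<and>
    (\<forall>i\<in>I. \<forall>j\<in>J. i \<noteq> j \<longrightarrow> path_image (\<gamma> i) \<subseteq> closure (U j)) \<and>
    (\<forall>i\<in>I \<inter> J. path_image (\<gamma> i) \<inter> closure (U i) \<inter> ball 0 r \<subseteq> {0})"
    using plane_sectors[where \<gamma> = \<gamma>, OF pat r(1) leg \<gamma>int] unfolding Y_def ..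
  then have U: "ball 0 r - Y = (\<Union>j\<in>J. U j)"
    "\<And>j. j \<in> J \<Longrightarrow> connected (U j)"
    "\<And>i j. \<lbrakk>i \<in> I; j \<in> J; i \<noteq> j\<rbrakk> \<Longrightarrow> path_image (\<gamma> i) \<subseteq> closure (U j)"
    "\<And>i. \<lbrakk>i \<in> I; i \<in> J\<rbrakk> \<Longrightarrow> path_image (\<gamma> i) \<inter> closure (U i) \<inter> ball 0 r \<subseteq> {0}"
    by simp_all
  \<comment> \<open>Everything in \<open>\<Gamma>\<close> except the legs; within distance \<open>s\<close> of \<open>x\<close>, only the legs remain.\<close>
  define R' where "R' = R \<union> (\<Union>i\<in>I. g i ` {t i..1})"
  have "closed (g i ` {t i..1})" if "i \<in> I" for i
    using t(1,2)[OF that]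
    by (intro compact_imp_closed compact_continuous_image continuous_on_subset[OF gc[OF that]]) auto
  then have "closed R'"
    unfolding R'_def using R finI by (intro closed_Un closed_UN) auto
  moreover have "x \<notin> R'"
  proof -
    have "g i u \<noteq> x" if i: "i \<in> I" and u: "u \<in> {t i..1}" for i u
    proof
      assume "g i u = x"
      then have "g i u = g i 0" using start[OF i] by (simp add: pathstart_def)
      then have "u = 0"
        using arc[OF i] u t(1)[OF i] by (auto simp: arc_def dest: inj_onD)
      then show False using u t(1)[OF i] by simp
    qed
    then have "x \<notin> g i ` {t i..1}" if "i \<in> I" for i
      using that by blast
    then show ?thesis using R(2) unfolding R'_def by blast
  qed
  ultimately obtain s' where s': "0 < s'" "h ` ball 0 s' \<inter> R' = {}"
    using near by blast
  define s where "s = min s' r"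
  have s: "0 < s" "s \<le> r" "h ` ball 0 s \<inter> R' = {}"
  proof -
    show "0 < s" "s \<le> r" using s' r by (simp_all add: s_def)
    have "h ` ball 0 s \<subseteq> h ` ball 0 s'" by (auto simp: s_def)
    then show "h ` ball 0 s \<inter> R' = {}" using s'(2) by blast
  qed
  have inY: "z \<in> path_image (\<gamma> i)" if i: "i \<in> I" and z: "z \<in> ball 0 s" "h z \<in> path_image (g i)" for i z
  proof -
    obtain u where u: "0 \<le> u" "u \<le> 1" "h z = g i u"
      using z(2) by (auto simp: path_image_def)
    have "h z \<notin> R'" using s(3) z(1) by blast
    then have "g i u \<notin> g i ` {t i..1}"
      using i unfolding u(3) R'_def by blast
    then have "u \<notin> {t i..1}" by blast
    then have "u \<in> {0..t i}" using u by auto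
    moreover have "z = f (g i u)"
      using fh_id[of z] u(3) by simp
    ultimately show ?thesis
      unfolding \<gamma>_im[OF i] by blast
  qed
  have off: "h z \<in> sphere 0 1 - \<Gamma>" if "z \<in> ball 0 s - Y" for z
  proof -
    have z: "z \<in> ball 0 s" "z \<notin> Y" using that by blast+
    then have "h z \<notin> R'" using s(3) by blast
    then have "h z \<notin> R" unfolding R'_def by blast
    moreover have "h z \<notin> path_image (g i)" if "i \<in> I" for i
      using inY[OF that z(1)] z(2) that unfolding Y_def by blast
    ultimately show ?thesis unfolding \<Gamma>_def using h_sph by blast
  qed
  have legD: "arc (\<gamma> i)" "pathstart (\<gamma> i) = 0" "pathfinish (\<gamma> i) \<in> sphere 0 r" if "i \<in> I" for i
    using leg[OF that] by (simp_all add: leg_def)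
  obtain \<delta> where "0 < \<delta> \<and> \<delta> \<le> s \<and> (\<forall>y\<in>ball 0 \<delta>. \<forall>y'\<in>ball 0 \<delta>.
    connected_component (ball 0 r - Y) y y' \<longrightarrow> connected_component (ball 0 s - Y) y y')"
    using nearby_points_stay_connected[where \<gamma> = \<gamma>, OF finI r(1) s(1) legD s(2)]
    unfolding Y_def ..
  then have \<delta>: "0 < \<delta>" "\<delta> \<le> s"
    "\<And>y y'. \<lbrakk>y \<in> ball 0 \<delta>; y' \<in> ball 0 \<delta>; connected_component (ball 0 r - Y) y y'\<rbrakk>
      \<Longrightarrow> connected_component (ball 0 s - Y) y y'"
    by blast+
  have \<delta>r: "\<delta> \<le> r" using \<delta> s by simp
  define V where "V = (\<lambda>j. h ` (U j \<inter> ball 0 \<delta>))"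
  define N where "N = h ` ball 0 \<delta>"
  have clU: "h z \<in> closure (V j)" if "z \<in> ball 0 \<delta>" "z \<in> closure (U j)" for z j
  proof -
    have "z \<in> closure (U j \<inter> ball 0 \<delta>)"
      using that open_Int_closure_subset[OF open_ball, of 0 \<delta> "U j"]
      by (simp only: Int_commute[of "U j"]) blast
    moreover have "h ` closure (U j \<inter> ball 0 \<delta>) \<subseteq> closure (V j)"
      unfolding V_def by (rule image_closure_subset[OF conth closed_closure closure_subset])
    ultimately show ?thesis by blast
  qed
  have gN: "\<exists>z. z \<in> path_image (\<gamma> i) \<and> z \<in> ball 0 \<delta> \<and> y = h z"
    if i: "i \<in> I" and y: "y \<in> path_image (g i)" "y \<in> N" for i y
  proof -
    obtain z where z: "z \<in> ball 0 \<delta>" "y = h z" using y by (auto simp: N_def)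
    then have "z \<in> ball 0 s" using \<delta> by auto
    then show ?thesis using inY[OF i] y z by blast
  qed
  show ?thesis
  proof (intro exI[of _ N] exI[of _ V] conjI ballI impI)
    show "openin (top_of_set (sphere 0 1)) N"
      unfolding N_def by (rule h_open) simp
    show "x \<in> N"
      unfolding N_def by (rule image_eqI[of _ _ 0]) (use h0 \<delta> in simp_all)
    show "N - \<Gamma> \<subseteq> (\<Union>j\<in>J. V j)"
    proof
      fix y assume y: "y \<in> N - \<Gamma>"
      then obtain z where z: "z \<in> ball 0 \<delta>" "y = h z" by (auto simp: N_def)
      have "z \<notin> Y"
        using y z(2) h\<gamma> unfolding Y_def \<Gamma>_def by blast
      then have "z \<in> (\<Union>j\<in>J. U j)"
        using z \<delta>r unfolding U(1)[symmetric] by auto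
      then show "y \<in> (\<Union>j\<in>J. V j)"
        unfolding V_def z(2) using z(1) by blast
    qed
    show "path_image (g i) \<inter> N \<subseteq> closure (V j)" if ij: "i \<in> I" "j \<in> J" "i \<noteq> j" for i j
      using gN[OF ij(1)] U(3)[OF ij] clU by blast
    show "\<exists>a \<in> components (sphere 0 1 - \<Gamma>). V j \<subseteq> a" if j: "j \<in> J" for j
    proof -
      obtain i where i: "i \<in> I" "i \<noteq> j"
        using pat by (auto simp: leg_pattern_def)
      have "0 \<in> path_image (\<gamma> i)"
        using pathstart_in_path_image[of "\<gamma> i"] legD(2)[OF i(1)] by simp
      then have "h 0 \<in> closure (V j)"
        using subsetD[OF U(3)[OF i(1) j i(2)]] clU[of 0 j] \<delta>(1) by simp
      then have "V j \<noteq> {}" by auto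
      then obtain y where y: "y \<in> U j" "y \<in> ball 0 \<delta>" by (auto simp: V_def)
      have *: "connected_component (sphere 0 1 - \<Gamma>) (h y) (h y')" if y': "y' \<in> U j" "y' \<in> ball 0 \<delta>" for y'
      proof -
        have "U j \<subseteq> ball 0 r - Y" using U(1) j by blast
        then have "connected_component (ball 0 r - Y) y y'"
          using U(2)[OF j] y y' unfolding connected_component_def by blast
        then have "connected_component (ball 0 s - Y) y y'"
          using \<delta>(3) y y' by blast
        then obtain T where T: "connected T" "T \<subseteq> ball 0 s - Y" "y \<in> T" "y' \<in> T"
          unfolding connected_component_def by blast
        then have "connected (h ` T)" "h ` T \<subseteq> sphere 0 1 - \<Gamma>"
          using off by (auto intro: connected_continuous_image conth)
        then show ?thesis
          unfolding connected_component_def using T(3,4) by blast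
      qed
      have "h y \<in> sphere 0 1 - \<Gamma>"
        using *[OF y] connected_component_in by blast
      then have "connected_component_set (sphere 0 1 - \<Gamma>) (h y) \<in> components (sphere 0 1 - \<Gamma>)"
        by (rule componentsI)
      moreover have "V j \<subseteq> connected_component_set (sphere 0 1 - \<Gamma>) (h y)"
        unfolding V_def using * by blast
      ultimately show ?thesis by blast
    qed
    show "path_image (g i) \<inter> N \<inter> closure (V i) \<subseteq> {x}" if "i \<in> I \<inter> J" for i
    proof
      have i: "i \<in> I" "i \<in> J" using that by blast+
      fix y assume y: "y \<in> path_image (g i) \<inter> N \<inter> closure (V i)"
      then obtain z where z: "z \<in> path_image (\<gamma> i)" "z \<in> ball 0 \<delta>" "y = h z"
        using gN[OF i(1)] by blast
      have "z \<in> closure (U i)"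
      proof (rule ccontr)
        assume "z \<notin> closure (U i)"
        define O' where "O' = - closure (U i)"
        have O': "open O'" "z \<in> O'"
          using \<open>z \<notin> closure (U i)\<close> unfolding O'_def by auto
        have OU: "w \<notin> O'" if "w \<in> U i" for w
          using that closure_subset[of "U i"] unfolding O'_def by blast
        obtain W' where W': "open W'" "h ` O' = sphere 0 1 \<inter> W'"
          using h_open[OF O'(1)] by (auto simp: openin_open)
        have "V i \<inter> h ` O' = {}"
          using OU by (auto simp: V_def h_inj)
        moreover have "V i \<subseteq> sphere 0 1"
          unfolding V_def using h_sph by blast
        ultimately have "V i \<inter> W' = {}"
          unfolding W'(2) by blast
        moreover have "y \<in> W'"
          using O'(2) z(3) W'(2) by blast
        ultimately show False
          using y W'(1) open_Int_closure_eq_empty[of W' "V i"] by blast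
      qed
      then have "z = 0"
      proof -
        have "z \<in> ball 0 r" using z(2) \<delta>r by auto
        with U(4)[OF i] z(1) \<open>z \<in> closure (U i)\<close> show ?thesis by blast
      qed
      then show "y \<in> {x}" using z h0 by simp
    qed
  qed
qed

section \<open>Faces of a cubic graph on the sphere\<close>

lemma edge_arc:
  assumes "embedded_graph G" "simple_mgraph G" "e \<in> edges G"
  obtains g where "arc g" "path_image g = e" "e \<subseteq> S2" "ends G e = {pathstart g, pathfinish g}"
    "e \<inter> verts G = ends G e"
proof -
  obtain g where g: "simple_path g" "path_image g = e" "e \<subseteq> S2"
    "ends G e = {pathstart g, pathfinish g}" "e \<inter> verts G = {pathstart g, pathfinish g}"
  proof -
    have "\<forall>e\<in>edges G. \<exists>g. simple_path g \<and> path_image g = e \<and> e \<subseteq> S2 \<and>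
        ends G e = {pathstart g, pathfinish g} \<and> e \<inter> verts G = {pathstart g, pathfinish g}"
      using assms(1) unfolding embedded_graph_def by (elim conjE)
    from bspec[OF this assms(3)] that show ?thesis by (elim exE conjE)
  qed
  have "card (ends G e) = 2"
    using assms(2,3) by (simp add: simple_mgraph_def)
  then have "pathfinish g \<noteq> pathstart g"
    using g(4) by auto
  then have "arc g"
    using g(1) by (simp add: arc_simple_path)
  then show ?thesis
    by (rule that) (use g in simp_all)
qed

lemma edge_arc_from:
  assumes "embedded_graph G" "simple_mgraph G" "e \<in> edges G" "v \<in> ends G e"
  obtains g where "arc g" "path_image g = e" "pathstart g = v"
proof -
  obtain g where g: "arc g" "path_image g = e" "ends G e = {pathstart g, pathfinish g}"
    using edge_arc[OF assms(1-3)] by metis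
  then consider "v = pathstart g" | "v = pathfinish g"
    using assms(4) by blast
  then show ?thesis
  proof cases
    case 1
    then show ?thesis using that[of g] g by simp
  next
    case 2
    then show ?thesis using that[of "reversepath g"] g by (simp add: arc_reversepath)
  qed
qed

lemma edge_interior:
  assumes "embedded_graph G" "simple_mgraph G" "e \<in> edges G"
  shows "connected (e - verts G)" "e - verts G \<noteq> {}" "e \<subseteq> closure (e - verts G)" "closed e"
proof -
  obtain g where g: "arc g" "path_image g = e" "ends G e = {pathstart g, pathfinish g}"
    "e \<inter> verts G = ends G e"
    using edge_arc[OF assms] by metis
  have "e - verts G = path_image g - {pathstart g, pathfinish g}"
    using g(2-4) by blast
  then show "connected (e - verts G)" "e - verts G \<noteq> {}" "e \<subseteq> closure (e - verts G)"
    using arc_interior[OF g(1)] g(2) by simp_all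
  show "closed e"
    using closed_arc_image[OF g(1)] g(2) by simp
qed

lemma closed_subgraph:
  assumes "embedded_graph G" "simple_mgraph G" "V \<subseteq> verts G" "E \<subseteq> edges G"
  shows "closed (V \<union> \<Union>E)"
proof -
  have "finite (verts G)" "finite (edges G)"
    using assms(1) by (auto simp: embedded_graph_def)
  then have "finite V" "finite E"
    using assms(3,4) finite_subset by blast+
  then show ?thesis
    using edge_interior(4)[OF assms(1,2)] assms(4)
    by (intro closed_Un closed_Union) (auto simp: finite_imp_closed)
qed

lemma closure_meets:
  assumes "openin (top_of_set S) N" "y \<in> N" "y \<in> closure A" "A \<subseteq> S"
  shows "N \<inter> A \<noteq> {}"
proof -
  obtain W where W: "open W" "N = S \<inter> W"
    using assms(1) by (auto simp: openin_open)
  then have "W \<inter> A \<noteq> {}"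
    using assms(2,3) open_Int_closure_eq_empty[of W A] by blast
  then show ?thesis using W(2) assms(4) by blast
qed

lemma face_unique:
  assumes "a \<in> faces G" "b \<in> faces G" "a \<inter> b \<noteq> {}"
  shows "a = b"
  using assms components_nonoverlap unfolding faces_def by blast

lemma face_subset:
  assumes "a \<in> faces G"
  shows "a \<subseteq> S2" "a \<inter> support G = {}"
  using in_components_subset assms unfolding faces_def by blast+

text \<open>
  The two halves of the edge are two arcs starting at \<open>x\<close>.
\<close>

lemma germ_at_edge_point:
  assumes emb: "embedded_graph G" and simple: "simple_mgraph G" and e: "e \<in> edges G"
    and x: "x \<in> e" "x \<notin> verts G"
  obtains N a b where "openin (top_of_set S2) N" "x \<in> N" "a \<in> faces G" "b \<in> faces G"
    "N - support G \<subseteq> a \<union> b" "e \<inter> N \<subseteq> closure a" "e \<inter> N \<subseteq> closure b"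
proof -
  obtain g where g: "arc g" "path_image g = e" "e \<subseteq> S2" "ends G e = {pathstart g, pathfinish g}"
    "e \<inter> verts G = ends G e"
    by (rule edge_arc[OF emb simple e])
  have "x \<noteq> pathstart g" "x \<noteq> pathfinish g"
    using x g(4,5) by blast+
  then obtain d0 d1 where d: "arc d0" "arc d1" "pathfinish d0 = x" "pathfinish d1 = x"
    "path_image d0 \<inter> path_image d1 = {x}" "path_image d0 \<union> path_image d1 = e"
    using arc_split[OF g(1)] x(1) unfolding g(2) by metis
  define h where "h = (\<lambda>i::nat. reversepath (if i = 0 then d0 else d1))"
  define R where "R = verts G \<union> \<Union>(edges G - {e})"
  let ?I = "{0, 1} :: nat set" and ?J = "{2, 3} :: nat set"
  have im: "(\<Union>i\<in>?I. path_image (h i)) = e"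
    using d(6) by (simp add: h_def)
  have supp: "R \<union> e = support G"
    unfolding R_def support_def using e by blast
  have pat: "leg_pattern ?I ?J" by (simp add: leg_pattern_def)
  have xS: "x \<in> S2" using x(1) g(3) by blast
  have h1: "arc (h i)" "pathstart (h i) = x" "path_image (h i) \<subseteq> S2" for i
    using d g(3) by (auto simp: h_def arc_reversepath)
  have h2: "\<forall>i\<in>?I. \<forall>j\<in>?I. i \<noteq> j \<longrightarrow> path_image (h i) \<inter> path_image (h j) = {x}"
    using d(5) by (simp add: h_def Int_commute)
  have R1: "closed R"
    unfolding R_def by (rule closed_subgraph[OF emb simple]) auto
  have R2: "x \<notin> R"
  proof
    assume "x \<in> R"
    then obtain e' where "e' \<in> edges G" "e' \<noteq> e" "x \<in> e'"
      using x(2) unfolding R_def by blast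
    then show False
      using emb e x unfolding embedded_graph_def by blast
  qed
  obtain N V where NV: "openin (top_of_set S2) N" "x \<in> N" "N - support G \<subseteq> (\<Union>j\<in>?J. V j)"
    "\<forall>j\<in>?J. \<exists>a\<in>faces G. V j \<subseteq> a"
    "\<forall>i\<in>?I. \<forall>j\<in>?J. i \<noteq> j \<longrightarrow> path_image (h i) \<inter> N \<subseteq> closure (V j)"
    using germ_sectors[where g = h, OF pat xS h1 h2 R1 R2, unfolded im supp, folded faces_def]
    by (elim exE conjE) (rule that)
  obtain a b where ab: "a \<in> faces G" "V 2 \<subseteq> a" "b \<in> faces G" "V 3 \<subseteq> b"
    using NV(4) by auto
  have "e \<inter> N \<subseteq> closure (V j)" if "j \<in> ?J" for j
  proof -
    have "path_image (h i) \<inter> N \<subseteq> closure (V j)" if "i \<in> ?I" for i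
      using NV(5) that \<open>j \<in> ?J\<close> by auto
    then show ?thesis
      unfolding im[symmetric] by blast
  qed
  then have "e \<inter> N \<subseteq> closure (V 2)" "e \<inter> N \<subseteq> closure (V 3)"
    by simp_all
  then have "e \<inter> N \<subseteq> closure a" "e \<inter> N \<subseteq> closure b"
    using closure_mono[OF ab(2)] closure_mono[OF ab(4)] by blast+
  moreover have "N - support G \<subseteq> a \<union> b"
    using NV(3) ab(2,4) by auto
  ultimately show ?thesis
    using that NV(1,2) ab(1,3) by blast
qed

text \<open>
  The three edges at \<open>v\<close> meet only in \<open>v\<close>: a second common point would be a common end vertex, and
  the graph has no multiple edges.
\<close>

lemma germ_at_vertex:
  assumes emb: "embedded_graph G" and simple: "simple_mgraph G" and v: "v \<in> verts G"
    and deg: "degree_of G v = 3"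
  obtains N and V a \<epsilon> :: "nat \<Rightarrow> (real^3) set" where
    "openin (top_of_set S2) N" "v \<in> N" "N - support G \<subseteq> (\<Union>j\<in>{0,1,2}. V j)"
    "\<forall>j\<in>{0,1,2}. a j \<in> faces G \<and> V j \<subseteq> a j"
    "\<forall>i\<in>{0,1,2}. \<epsilon> i \<in> edges G \<and> v \<in> \<epsilon> i"
    "\<forall>i\<in>{0,1,2}. \<forall>j\<in>{0,1,2}. i \<noteq> j \<longrightarrow> \<epsilon> i \<inter> N \<subseteq> closure (V j)"
    "\<forall>i\<in>{0,1,2}. \<epsilon> i \<inter> N \<inter> closure (V i) \<subseteq> {v}"
proof -
  let ?I = "{0, 1, 2} :: nat set"
  have card2: "card (ends G e) = 2" if "e \<in> edges G" for e
    using simple that by (simp add: simple_mgraph_def)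
  then have "{e \<in> edges G. ends G e = {v}} = {}"
    by fastforce
  then have "card {e \<in> edges G. v \<in> ends G e} = 3"
    using deg by (simp only: degree_of_def card.empty add_0_right)
  then obtain e0 e1 e2 where E: "{e \<in> edges G. v \<in> ends G e} = {e0, e1, e2}"
    and ne: "e0 \<noteq> e1" "e0 \<noteq> e2" "e1 \<noteq> e2"
    unfolding card_3_iff by metis
  define \<epsilon> where "\<epsilon> = (\<lambda>i::nat. if i = 0 then e0 else if i = 1 then e1 else e2)"
  have \<epsilon>: "\<epsilon> i \<in> edges G" "v \<in> ends G (\<epsilon> i)" for i
    using E by (auto simp: \<epsilon>_def)
  have \<epsilon>_inj: "\<epsilon> i \<noteq> \<epsilon> j" if "i \<in> ?I" "j \<in> ?I" "i \<noteq> j" for i j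
    using that ne by (auto simp: \<epsilon>_def)
  have "\<exists>g. arc g \<and> path_image g = \<epsilon> i \<and> pathstart g = v" for i
    using edge_arc_from[OF emb simple \<epsilon>] by metis
  then obtain g where g: "\<And>i. arc (g i)" "\<And>i. path_image (g i) = \<epsilon> i" "\<And>i. pathstart (g i) = v"
    by metis
  have ends: "\<epsilon>' \<inter> verts G = ends G \<epsilon>'" "\<epsilon>' \<subseteq> S2" if "\<epsilon>' \<in> edges G" for \<epsilon>'
    using edge_arc[OF emb simple that] by metis+
  have v\<epsilon>: "v \<in> \<epsilon> i" for i
    using ends(1)[OF \<epsilon>(1)] \<epsilon>(2) by blast
  have int: "\<forall>i\<in>?I. \<forall>j\<in>?I. i \<noteq> j \<longrightarrow> path_image (g i) \<inter> path_image (g j) = {v}"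
  proof (intro ballI impI)
    fix i j assume ij: "i \<in> ?I" "j \<in> ?I" "i \<noteq> j"
    have "w = v" if w: "w \<in> \<epsilon> i" "w \<in> \<epsilon> j" for w
    proof (rule ccontr)
      assume "w \<noteq> v"
      have "\<epsilon> i \<inter> \<epsilon> j \<subseteq> verts G"
        using emb \<epsilon>(1) \<epsilon>_inj[OF ij] unfolding embedded_graph_def by blast
      then have w': "w \<in> ends G (\<epsilon> i)" "w \<in> ends G (\<epsilon> j)"
        using w ends(1)[OF \<epsilon>(1)] by blast+
      have ends_w: "ends G (\<epsilon> k) = {v, w}" if "w \<in> ends G (\<epsilon> k)" for k
      proof (rule card_subset_eq[symmetric])
        show "finite (ends G (\<epsilon> k))"
          using card2[OF \<epsilon>(1)[of k]] by (intro card_ge_0_finite) simp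
      qed (use that \<epsilon>(2) card2[OF \<epsilon>(1)[of k]] \<open>w \<noteq> v\<close> in auto)
      have "ends G (\<epsilon> i) = ends G (\<epsilon> j)"
        using ends_w[OF w'(1)] ends_w[OF w'(2)] by simp
      then have "\<epsilon> i = \<epsilon> j"
        using simple \<epsilon>(1) unfolding simple_mgraph_def by (blast dest: inj_onD)
      then show False using \<epsilon>_inj[OF ij] by blast
    qed
    then show "path_image (g i) \<inter> path_image (g j) = {v}"
      unfolding g(2) using v\<epsilon> by blast
  qed
  define R where "R = (verts G - {v}) \<union> \<Union>(edges G - {e0, e1, e2})"
  have im: "(\<Union>i\<in>?I. path_image (g i)) = e0 \<union> e1 \<union> e2"
    unfolding g(2) by (simp add: \<epsilon>_def Un_ac)
  have supp: "R \<union> (e0 \<union> e1 \<union> e2) = support G"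
  proof -
    have "v \<in> e0" "{e0, e1, e2} \<subseteq> edges G"
      using v\<epsilon>[of 0] E by (auto simp: \<epsilon>_def)
    then show ?thesis
      unfolding R_def support_def by blast
  qed
  have vS: "v \<in> S2"
    using emb v unfolding embedded_graph_def by blast
  have R1: "closed R"
    unfolding R_def by (rule closed_subgraph[OF emb simple]) auto
  have R2: "v \<notin> R"
  proof
    assume "v \<in> R"
    then obtain e' where e': "e' \<in> edges G" "e' \<notin> {e0, e1, e2}" "v \<in> e'"
      unfolding R_def by blast
    then have "v \<in> ends G e'"
      using ends(1) v by blast
    then show False using e' E by blast
  qed
  have pat: "leg_pattern ?I ?I" by (simp add: leg_pattern_def)
  have gS: "path_image (g i) \<subseteq> S2" for i
    unfolding g(2) by (rule ends(2)[OF \<epsilon>(1)])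
  obtain N V where NV: "openin (top_of_set S2) N" "v \<in> N" "N - support G \<subseteq> (\<Union>j\<in>?I. V j)"
    "\<forall>j\<in>?I. \<exists>a\<in>faces G. V j \<subseteq> a"
    "\<forall>i\<in>?I. \<forall>j\<in>?I. i \<noteq> j \<longrightarrow> path_image (g i) \<inter> N \<subseteq> closure (V j)"
    "\<forall>i\<in>?I \<inter> ?I. path_image (g i) \<inter> N \<inter> closure (V i) \<subseteq> {v}"
    using germ_sectors[where g = g, OF pat vS g(1,3) gS int R1 R2, unfolded im supp, folded faces_def]
    by (elim exE conjE) (rule that)
  have "\<exists>a. \<forall>j\<in>?I. a j \<in> faces G \<and> V j \<subseteq> a j"
    using NV(4) by (intro bchoice) blast
  then obtain a where a: "\<forall>j\<in>?I. a j \<in> faces G \<and> V j \<subseteq> a j" ..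
  have "\<forall>i\<in>?I. \<epsilon> i \<in> edges G \<and> v \<in> \<epsilon> i"
    using \<epsilon>(1) v\<epsilon> by blast
  moreover have "\<forall>i\<in>?I. \<forall>j\<in>?I. i \<noteq> j \<longrightarrow> \<epsilon> i \<inter> N \<subseteq> closure (V j)"
    using NV(5) unfolding g(2) .
  moreover have "\<forall>i\<in>?I. \<epsilon> i \<inter> N \<inter> closure (V i) \<subseteq> {v}"
    using NV(6) unfolding g(2) Int_absorb .
  ultimately show ?thesis
    by (rule that[OF NV(1-3) a])
qed

text \<open>
  If a face accumulates at an interior point of an edge, it contains one of the two sectors there, so
  it accumulates at all nearby points of the edge.  As the interior of the edge is connected, this
  propagates along the whole edge.
\<close>

lemma edge_in_closure_of_face:
  assumes emb: "embedded_graph G" and simple: "simple_mgraph G" and e: "e \<in> edges G"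
    and a: "a \<in> faces G" and x: "x \<in> e" "x \<notin> verts G" "x \<in> closure a"
  shows "e \<subseteq> closure a"
proof -
  have "y \<in> closure a" if "y \<in> e - verts G" for y
  proof (rule connected_induction_simple[OF edge_interior(1)[OF emb simple e], where P = "\<lambda>y. y \<in> closure a"])
    fix u assume u: "u \<in> e - verts G"
    obtain N b c where N: "openin (top_of_set S2) N" "u \<in> N" "b \<in> faces G" "c \<in> faces G"
      "N - support G \<subseteq> b \<union> c" "e \<inter> N \<subseteq> closure b" "e \<inter> N \<subseteq> closure c"
      using germ_at_edge_point[OF emb simple e] u by blast
    have "e \<subseteq> S2" by (rule edge_arc[OF emb simple e])
    then have "openin (top_of_set (e - verts G)) ((e - verts G) \<inter> N)"
    proof -
      obtain W where "open W" "N = S2 \<inter> W"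
        using N(1) by (auto simp: openin_open)
      moreover have "(e - verts G) \<inter> (S2 \<inter> W) = (e - verts G) \<inter> W"
        using \<open>e \<subseteq> S2\<close> by blast
      ultimately show ?thesis by (simp only: openin_open_Int)
    qed
    moreover have "z \<in> closure a" if "y \<in> (e - verts G) \<inter> N" "z \<in> (e - verts G) \<inter> N" "y \<in> closure a" for y z
    proof -
      have "N \<inter> a \<noteq> {}"
        using closure_meets[OF N(1) _ that(3) face_subset(1)[OF a]] that(1) by blast
      then have "a \<inter> b \<noteq> {} \<or> a \<inter> c \<noteq> {}"
        using N(5) face_subset(2)[OF a] by blast
      then have "a = b \<or> a = c"
        using face_unique a N(3,4) by blast
      then show ?thesis using N(6,7) that(2) by blast
    qed
    ultimately show "\<exists>T. openin (top_of_set (e - verts G)) T \<and> u \<in> T \<and>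
        (\<forall>y\<in>T. \<forall>z\<in>T. y \<in> closure a \<longrightarrow> z \<in> closure a)"
      using u N(2) by (intro exI[of _ "(e - verts G) \<inter> N"]) blast
  qed (use x that in auto)
  then have "closure (e - verts G) \<subseteq> closure a"
    by (intro closure_minimal) auto
  then show ?thesis
    using edge_interior(3)[OF emb simple e] by blast
qed

text \<open>
  Every point of the sphere has a neighbourhood that meets at most three faces, and the sphere is
  compact.
\<close>

lemma finite_faces:
  assumes emb: "embedded_graph G" and simple: "simple_mgraph G" and cub: "cubic G"
  shows "finite (faces G)"
proof -
  have fin_meet: "finite {a \<in> faces G. a \<inter> N \<noteq> {}}"
    if F: "finite F" "F \<subseteq> faces G" "N - support G \<subseteq> \<Union>F" for N F
  proof (rule finite_subset[OF _ F(1)])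
    show "{a \<in> faces G. a \<inter> N \<noteq> {}} \<subseteq> F"
    proof
      fix a assume "a \<in> {a \<in> faces G. a \<inter> N \<noteq> {}}"
      then obtain y where y: "a \<in> faces G" "y \<in> a" "y \<in> N" by blast
      then have "y \<in> N - support G"
        using face_subset(2)[OF y(1)] by blast
      then obtain b where "b \<in> F" "y \<in> b" using F(3) by blast
      then show "a \<in> F"
        using face_unique[OF y(1), of b] y(2) F(2) by blast
    qed
  qed
  have "\<exists>N. openin (top_of_set S2) N \<and> x \<in> N \<and> finite {a \<in> faces G. a \<inter> N \<noteq> {}}" if x: "x \<in> S2" for x
  proof -
    consider "x \<in> verts G" | e where "e \<in> edges G" "x \<in> e" "x \<notin> verts G" | "x \<notin> support G"
      unfolding support_def by blast
    then show ?thesis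
    proof cases
      case 1
      then have deg: "degree_of G x = 3" using cub by (simp add: cubic_def)
      obtain N and V a \<epsilon> :: "nat \<Rightarrow> (real^3) set" where N:
        "openin (top_of_set S2) N" "x \<in> N" "N - support G \<subseteq> (\<Union>j\<in>{0,1,2}. V j)"
        "\<forall>j\<in>{0,1,2}. a j \<in> faces G \<and> V j \<subseteq> a j"
        by (rule germ_at_vertex[OF emb simple 1 deg])
      have "N - support G \<subseteq> \<Union>(a ` {0,1,2})"
        using N(3,4) by blast
      then have "finite {a \<in> faces G. a \<inter> N \<noteq> {}}"
        using N(4) by (intro fin_meet[of "a ` {0,1,2}"]) auto
      then show ?thesis using N(1,2) by blast
    next
      case 2
      obtain N a b where N: "openin (top_of_set S2) N" "x \<in> N" "a \<in> faces G" "b \<in> faces G"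
        "N - support G \<subseteq> a \<union> b"
        by (rule germ_at_edge_point[OF emb simple 2])
      have "finite {a \<in> faces G. a \<inter> N \<noteq> {}}"
        using N(3-5) by (intro fin_meet[of "{a, b}"]) auto
      then show ?thesis using N(1,2) by blast
    next
      case 3
      let ?a = "connected_component_set (S2 - support G) x"
      have "openin (top_of_set S2) (S2 - support G)"
        using closed_subgraph[OF emb simple order_refl order_refl]
        unfolding support_def by (metis Diff_eq openin_open_Int open_Compl)
      moreover from this have "openin (top_of_set (S2 - support G)) ?a"
        by (intro openin_connected_component_locally_connected locally_open_subset[OF locally_connected_sphere])
      ultimately have "openin (top_of_set S2) ?a"
        by (rule openin_trans[rotated])
      moreover have "x \<in> ?a" using x 3 by simp
      moreover have "?a \<in> faces G"
        unfolding faces_def using x 3 by (intro componentsI) simp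
      then have "finite {a \<in> faces G. a \<inter> ?a \<noteq> {}}"
        by (intro fin_meet[of "{?a}"]) auto
      ultimately show ?thesis by blast
    qed
  qed
  then have "\<forall>x\<in>S2. \<exists>N. openin (top_of_set S2) N \<and> x \<in> N \<and> finite {a \<in> faces G. a \<inter> N \<noteq> {}}"
    by (intro ballI)
  from bchoice[OF this] obtain N where
    "\<forall>x\<in>S2. openin (top_of_set S2) (N x) \<and> x \<in> N x \<and> finite {a \<in> faces G. a \<inter> N x \<noteq> {}}" ..
  then have N: "\<And>x. x \<in> S2 \<Longrightarrow> openin (top_of_set S2) (N x)" "\<And>x. x \<in> S2 \<Longrightarrow> x \<in> N x"
    "\<And>x. x \<in> S2 \<Longrightarrow> finite {a \<in> faces G. a \<inter> N x \<noteq> {}}"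
    by simp_all
  have "\<forall>x\<in>S2. \<exists>W. open W \<and> N x = S2 \<inter> W"
    using N(1) by (simp add: openin_open)
  from bchoice[OF this] obtain W where W: "\<And>x. x \<in> S2 \<Longrightarrow> open (W x)" "\<And>x. x \<in> S2 \<Longrightarrow> N x = S2 \<inter> W x"
    by blast
  have "S2 \<subseteq> (\<Union>x\<in>S2. W x)"
    using N(2) W(2) by blast
  then obtain C where C: "C \<subseteq> S2" "finite C" "S2 \<subseteq> (\<Union>x\<in>C. W x)"
    using compactE_image[of S2 S2 W] W(1) by (metis compact_sphere)
  have "faces G \<subseteq> (\<Union>x\<in>C. {a \<in> faces G. a \<inter> N x \<noteq> {}})"
  proof
    fix a assume a: "a \<in> faces G"
    then obtain y where y: "y \<in> a" "y \<in> S2"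
      using face_subset(1)[OF a] in_components_nonempty unfolding faces_def by blast
    then obtain x where x: "x \<in> C" "y \<in> W x" using C(3) by blast
    then have "y \<in> N x" using W(2) C(1) y(2) by blast
    then show "a \<in> (\<Union>x\<in>C. {a \<in> faces G. a \<inter> N x \<noteq> {}})"
      using a y(1) x(1) by blast
  qed
  then show ?thesis
    using C(1,2) N(3) by (meson finite_UN_I finite_subset subsetD)
qed

text \<open>
  Each edge at \<open>v\<close> has on its sides the faces that contain the two sectors next to it, and no others,
  since the opposite sector stays away from its points near \<open>v\<close>.  The three faces need not be distinct
  here; if two of them agree, some edge has the same face on both sides.
\<close>

lemma three_faces_at_vertex:
  assumes emb: "embedded_graph G" and simple: "simple_mgraph G" and v: "v \<in> verts G"
    and deg: "degree_of G v = 3"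
  obtains a b c e e' e'' where "{a, b, c} \<subseteq> faces G" "{e, e', e''} \<subseteq> edges G"
    "sides G e = {b, c}" "sides G e' = {a, c}" "sides G e'' = {a, b}"
proof -
  let ?I = "{0, 1, 2} :: nat set"
  obtain N and V a \<epsilon> :: "nat \<Rightarrow> (real^3) set" where
    N: "openin (top_of_set S2) N" "v \<in> N" "N - support G \<subseteq> (\<Union>j\<in>?I. V j)"
    and a: "\<forall>j\<in>?I. a j \<in> faces G \<and> V j \<subseteq> a j"
    and \<epsilon>: "\<forall>i\<in>?I. \<epsilon> i \<in> edges G \<and> v \<in> \<epsilon> i"
    and adj: "\<forall>i\<in>?I. \<forall>j\<in>?I. i \<noteq> j \<longrightarrow> \<epsilon> i \<inter> N \<subseteq> closure (V j)"
    and opp: "\<forall>i\<in>?I. \<epsilon> i \<inter> N \<inter> closure (V i) \<subseteq> {v}"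
    by (rule germ_at_vertex[OF emb simple v deg])
  have sides: "sides G (\<epsilon> i) = a ` (?I - {i})" if i: "i \<in> ?I" for i
  proof -
    have e: "\<epsilon> i \<in> edges G" "v \<in> \<epsilon> i" using \<epsilon> i by blast+
    have eS: "\<epsilon> i \<subseteq> S2" by (rule edge_arc[OF emb simple e(1)])
    have "N \<inter> (\<epsilon> i - verts G) \<noteq> {}"
      using closure_meets[OF N(1,2), of "\<epsilon> i - verts G"] edge_interior(3)[OF emb simple e(1)] e(2) eS
      by blast
    then obtain y where y: "y \<in> N" "y \<in> \<epsilon> i" "y \<notin> verts G" by blast
    show ?thesis
    proof
      show "a ` (?I - {i}) \<subseteq> sides G (\<epsilon> i)"
      proof (rule image_subsetI)
        fix j assume "j \<in> ?I - {i}"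
        then have j: "j \<in> ?I" "i \<noteq> j" by blast+
        define b where "b = a j"
        have b: "b \<in> faces G" "V j \<subseteq> b" using a j(1) unfolding b_def by blast+
        have "y \<in> closure (V j)"
          using adj i j(1,2) y(1,2) by blast
        then have "y \<in> closure b"
          using closure_mono[OF b(2)] by blast
        then have "\<epsilon> i \<subseteq> closure b"
          using edge_in_closure_of_face[OF emb simple e(1) b(1) y(2,3)] by blast
        then show "a j \<in> sides G (\<epsilon> i)"
          using b(1) unfolding b_def by (simp add: sides_def)
      qed
      show "sides G (\<epsilon> i) \<subseteq> a ` (?I - {i})"
      proof
        fix b assume "b \<in> sides G (\<epsilon> i)"
        then have b: "b \<in> faces G" "\<epsilon> i \<subseteq> closure b" by (auto simp: sides_def)
        have "openin (top_of_set S2) (N - closure (V i))"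
          using N(1) by (metis Diff_eq closed_closure open_Compl openin_Int_open)
        moreover have "y \<in> N - closure (V i)"
          using opp i y v by blast
        ultimately have "(N - closure (V i)) \<inter> b \<noteq> {}"
          using closure_meets[of S2 "N - closure (V i)" y b] b y(2) face_subset(1)[OF b(1)] by blast
        then obtain z where z: "z \<in> N" "z \<notin> closure (V i)" "z \<in> b" by blast
        then have "z \<in> (\<Union>j\<in>?I. V j)"
          using N(3) face_subset(2)[OF b(1)] by blast
        then obtain j where j: "j \<in> ?I" "z \<in> V j" by blast
        have "j \<noteq> i" using z(2) j(2) closure_subset by blast
        moreover have "b = a j"
          using face_unique[OF b(1), of "a j"] a j z(3) by blast
        ultimately show "b \<in> a ` (?I - {i})" using j(1) by blast
      qed
    qed
  qed
  have "sides G (\<epsilon> 0) = {a 1, a 2}" "sides G (\<epsilon> 1) = {a 0, a 2}" "sides G (\<epsilon> 2) = {a 0, a 1}"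
    using sides[of 0] sides[of 1] sides[of 2] by (simp_all add: insert_Diff_if)
  moreover have "{a 0, a 1, a 2} \<subseteq> faces G" "{\<epsilon> 0, \<epsilon> 1, \<epsilon> 2} \<subseteq> edges G"
    using a \<epsilon> by simp_all
  ultimately show ?thesis
    by (intro that[of "a 0" "a 1" "a 2" "\<epsilon> 0" "\<epsilon> 1" "\<epsilon> 2"])
qed

section \<open>The projective line\<close>

definition line :: "'k::field ^ 2 \<Rightarrow> ('k ^ 2) set" where
  "line v = range (\<lambda>c. c *s v)"

definition vec2 :: "'k \<Rightarrow> 'k \<Rightarrow> 'k ^ 2" where
  "vec2 x y = (\<chi> i. if i = 1 then x else y)"

lemma vec2_nth [simp]: "vec2 x y $ 1 = x" "vec2 x y $ 2 = y"
  by (simp_all add: vec2_def)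

lemma vec_eq2: "v = w \<longleftrightarrow> v $ 1 = w $ 1 \<and> v $ 2 = w $ 2" for v w :: "'k ^ 2"
  by (simp add: vec_eq_iff forall_2)

lemma mat_mult_nth2:
  fixes A :: "'k::field ^ 2 ^ 2"
  shows "(A *v v) $ i = A $ i $ 1 * v $ 1 + A $ i $ 2 * v $ 2"
  by (simp add: matrix_vector_mult_def sum_2)

lemma P1_lines: "P1 = line ` (- {0})"
  by (auto simp: P1_def line_def)

lemma line_in_P1: "v \<noteq> 0 \<Longrightarrow> line v \<in> P1"
  by (auto simp: P1_lines)

lemma P1_cases:
  assumes "L \<in> P1"
  obtains v where "v \<noteq> 0" "L = line v"
  using assms by (auto simp: P1_lines)

lemma line_scale:
  assumes "c \<noteq> 0"
  shows "line (c *s v) = line v"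
proof -
  have "(\<lambda>d. d *s v) = (\<lambda>d. d *s (c *s v)) \<circ> (\<lambda>d. d / c)"
    using assms by (auto simp: fun_eq_iff)
  moreover have "range (\<lambda>d. d / c) = UNIV"
    using assms by (intro surjI[of _ "\<lambda>d. d * c"]) simp
  ultimately show ?thesis
    unfolding line_def by (metis image_comp)
qed

text \<open>
  Equality of points of the projective line becomes a polynomial identity in the homogeneous
  coordinates.
\<close>

lemma line_eq_iff_det:
  fixes v w :: "'k::field ^ 2"
  assumes "v \<noteq> 0" "w \<noteq> 0"
  shows "line v = line w \<longleftrightarrow> v $ 1 * w $ 2 = v $ 2 * w $ 1"
proof
  assume "line v = line w"
  moreover have "v \<in> line v"
    unfolding line_def by (rule range_eqI[of _ _ 1]) simp
  ultimately obtain c where "v = c *s w"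
    by (auto simp: line_def)
  then show "v $ 1 * w $ 2 = v $ 2 * w $ 1" by simp
next
  assume d: "v $ 1 * w $ 2 = v $ 2 * w $ 1"
  obtain c where c: "c \<noteq> 0" "v = c *s w"
  proof (cases "w $ 1 = 0")
    case True
    then have "w $ 2 \<noteq> 0" using assms(2) by (simp add: vec_eq2)
    then have "v = (v $ 2 / w $ 2) *s w" "v $ 1 = 0"
      using d True by (simp_all add: vec_eq2)
    then show ?thesis using that[of "v $ 2 / w $ 2"] assms(1) \<open>w $ 2 \<noteq> 0\<close> by (auto simp: vec_eq2)
  next
    case False
    then have "v = (v $ 1 / w $ 1) *s w"
      using d by (simp add: vec_eq2 field_simps)
    moreover from this have "v $ 1 / w $ 1 \<noteq> 0"
      using assms(1) by (metis vector_smult_lzero)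
    ultimately show ?thesis using that by blast
  qed
  then show "line v = line w" by (simp add: line_scale)
qed

abbreviation pt :: "'k::field \<Rightarrow> ('k ^ 2) set" where
  "pt x \<equiv> line (vec2 x 1)"

abbreviation pt_inf :: "('k::field ^ 2) set" where
  "pt_inf \<equiv> line (vec2 1 0)"

lemma vec2_neq_0 [simp]: "vec2 x 1 \<noteq> 0" "vec2 1 y \<noteq> 0" for x y :: "'k::field"
  by (simp_all add: vec_eq2)

lemma pts_distinct [simp]:
  "pt x = pt y \<longleftrightarrow> x = y" "pt x \<noteq> pt_inf" "pt_inf \<noteq> pt x"
  by (auto simp: line_eq_iff_det)

lemma P1_pts: "P1 = insert pt_inf (range pt)"
proof
  show "P1 \<subseteq> insert (pt_inf :: ('k::field ^ 2) set) (range pt)"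
  proof
    fix L :: "('k ^ 2) set" assume "L \<in> P1"
    then obtain v where v: "v \<noteq> 0" "L = line v" by (rule P1_cases)
    have "L = pt_inf \<or> L = pt (v $ 1 / v $ 2)"
      using v by (cases "v $ 2 = 0") (simp_all add: line_eq_iff_det)
    then show "L \<in> insert pt_inf (range pt)" by blast
  qed
qed (auto intro: line_in_P1)

definition act :: "'k::field ^ 2 ^ 2 \<Rightarrow> ('k ^ 2) set \<Rightarrow> ('k ^ 2) set" where
  "act A L = (\<lambda>v. A *v v) ` L"

lemma act_line: "act A (line v) = line (A *v v)"
proof -
  have "A *v (c *s v) = c *s (A *v v)" for c
    by (simp add: vec_eq2 mat_mult_nth2 algebra_simps)
  then show ?thesis
    by (simp add: act_def line_def image_image)
qed

lemma act_mult: "act (A ** B) L = act A (act B L)"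
  by (simp add: act_def image_image matrix_vector_mul_assoc)

lemma act_one: "act (mat 1) L = L"
  by (simp add: act_def)

lemma invertible_nonzero:
  fixes A :: "'k::field ^ 2 ^ 2"
  assumes "invertible A" "v \<noteq> 0"
  shows "A *v v \<noteq> 0"
  by (metis assms invertible_def matrix_vector_mul_assoc matrix_vector_mul_lid matrix_vector_mult_0_right)

lemma act_P1:
  assumes "invertible A" "L \<in> P1"
  shows "act A L \<in> P1"
proof -
  obtain v where "v \<noteq> 0" "L = line v" using assms(2) by (rule P1_cases)
  then show ?thesis
    using invertible_nonzero[OF assms(1)] by (simp add: act_line line_in_P1)
qed

lemma inverse_matrix:
  fixes A :: "'k::field ^ 2 ^ 2"
  assumes "invertible A"
  obtains B where "invertible B" "A ** B = mat 1" "B ** A = mat 1"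
proof -
  obtain B where "A ** B = mat 1" "B ** A = mat 1"
    using assms unfolding invertible_def by (elim exE conjE)
  moreover from this have "invertible B"
    unfolding invertible_def by (intro exI[of _ A] conjI)
  ultimately show ?thesis by (intro that)
qed

lemma act_inj:
  assumes "invertible A" "act A L = act A L'"
  shows "L = L'"
  using inverse_matrix[OF assms(1)] assms(2) by (metis act_mult act_one)

text \<open>
  Let \<open>u\<close>, \<open>w\<close>, \<open>t\<close> span the three lines.  By Cramer's rule \<open>t = \<alpha> u + \<beta> w\<close>, and \<open>\<alpha>\<close>, \<open>\<beta>\<close> are not zero because the
  lines are distinct.  The matrix with columns \<open>\<alpha> u\<close> and \<open>\<beta> w\<close> maps \<open>(1, 0)\<close>, \<open>(0, 1)\<close>, \<open>(1, 1)\<close> as required.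
\<close>

lemma move_standard_to:
  fixes L L' L'' :: "('k::field ^ 2) set"
  assumes "L \<in> P1" "L' \<in> P1" "L'' \<in> P1" "L \<noteq> L'" "L \<noteq> L''" "L' \<noteq> L''"
  obtains A where "invertible A" "act A pt_inf = L" "act A (pt 0) = L'" "act A (pt 1) = L''"
proof -
  obtain u w t where uwt: "u \<noteq> 0" "L = line u" "w \<noteq> 0" "L' = line w" "t \<noteq> 0" "L'' = line t"
    using assms(1-3) by (metis P1_cases)
  define D where "D = u $ 1 * w $ 2 - u $ 2 * w $ 1"
  define \<alpha> where "\<alpha> = (t $ 1 * w $ 2 - t $ 2 * w $ 1) / D"
  define \<beta> where "\<beta> = (u $ 1 * t $ 2 - u $ 2 * t $ 1) / D"
  have D: "D \<noteq> 0" and \<alpha>: "\<alpha> \<noteq> 0" and \<beta>: "\<beta> \<noteq> 0"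
    using assms(4-6) uwt by (auto simp: D_def \<alpha>_def \<beta>_def line_eq_iff_det mult.commute)
  define A :: "'k ^ 2 ^ 2" where "A = (\<chi> i j. if j = 1 then \<alpha> * u $ i else \<beta> * w $ i)"
  have "det A = \<alpha> * \<beta> * D"
    by (simp add: det_2 A_def D_def algebra_simps)
  then have "invertible A"
    using D \<alpha> \<beta> by (simp add: invertible_det_nz)
  moreover have "A *v vec2 1 0 = \<alpha> *s u" "A *v vec2 0 1 = \<beta> *s w"
    by (simp_all add: vec_eq2 mat_mult_nth2 A_def)
  moreover have "A *v vec2 1 1 = t"
  proof -
    have D\<alpha>: "D * \<alpha> = t $ 1 * w $ 2 - t $ 2 * w $ 1" and D\<beta>: "D * \<beta> = u $ 1 * t $ 2 - u $ 2 * t $ 1"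
      using D by (simp_all add: \<alpha>_def \<beta>_def)
    have "D * (\<alpha> * u $ i + \<beta> * w $ i) = D * t $ i" if "i = 1 \<or> i = 2" for i
    proof -
      have "D * (\<alpha> * u $ i + \<beta> * w $ i) = (D * \<alpha>) * u $ i + (D * \<beta>) * w $ i"
        by (simp add: algebra_simps)
      also have "\<dots> = D * t $ i"
        unfolding D\<alpha> D\<beta> unfolding D_def using that by (auto simp: algebra_simps)
      finally show ?thesis .
    qed
    then show ?thesis
      using D by (simp add: vec_eq2 mat_mult_nth2 A_def)
  qed
  ultimately show ?thesis
    using that[of A] uwt \<alpha> \<beta> by (simp add: act_line line_scale)
qed

lemma move_to_standard:
  fixes L L' L'' :: "('k::field ^ 2) set"
  assumes "L \<in> P1" "L' \<in> P1" "L'' \<in> P1" "L \<noteq> L'" "L \<noteq> L''" "L' \<noteq> L''"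
  obtains A where "invertible A" "act A L = pt_inf" "act A L' = pt 0" "act A L'' = pt 1"
proof -
  obtain B where B: "invertible B" "act B pt_inf = L" "act B (pt 0) = L'" "act B (pt 1) = L''"
    using move_standard_to[OF assms] .
  obtain A where "invertible A" "A ** B = mat 1"
    using inverse_matrix[OF B(1)] by metis
  then show ?thesis
    using that[of A] B(2-4) by (metis act_mult act_one)
qed

text \<open>
  Fixing \<open>pt_inf\<close> and \<open>pt 0\<close> makes the matrix diagonal, and fixing \<open>pt 1\<close> makes it scalar.
\<close>

lemma fixing_standard_is_trivial:
  assumes A: "act A pt_inf = pt_inf" "act A (pt 0) = pt 0" "act A (pt 1) = pt 1"
    and inv: "invertible A" and L: "L \<in> P1"
  shows "act A L = L"
proof -
  have nz: "A *v v \<noteq> 0" if "v \<noteq> 0" for v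
    using inv that by (rule invertible_nonzero)
  have "A $ 2 $ 1 = 0" "A $ 1 $ 2 = 0"
    using A(1,2) nz[of "vec2 1 0"] nz[of "vec2 0 1"]
    by (simp_all add: act_line line_eq_iff_det mat_mult_nth2)
  moreover from this have "A $ 1 $ 1 = A $ 2 $ 2"
    using A(3) nz[of "vec2 1 1"] by (simp add: act_line line_eq_iff_det mat_mult_nth2)
  ultimately have "A *v v = A $ 1 $ 1 *s v" for v
    by (simp add: vec_eq2 mat_mult_nth2)
  moreover obtain v where v: "v \<noteq> 0" "L = line v" using L by (rule P1_cases)
  moreover have "A $ 1 $ 1 \<noteq> 0"
    using nz[OF v(1)] calculation(1) by (metis vector_smult_lzero)
  ultimately show ?thesis by (simp add: act_line line_scale)
qed

section \<open>The Frobenius automorphism\<close>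

text \<open>
  Multiplication by \<open>x \<noteq> 0\<close> permutes the nonzero elements, so it preserves their product.
\<close>

lemma finite_field_power_card:
  fixes x :: "'f::{field,finite}"
  shows "x ^ CARD('f) = x"
proof (cases "x = 0")
  case False
  let ?q = "CARD('f)"
  have "x * (\<Prod>y\<in>UNIV-{0}. x * y) = x * x ^ (?q - 1) * \<Prod>(UNIV-{0})"
    by (simp add: prod.distrib mult_ac)
  also have "x * x ^ (?q - 1) = x ^ ?q"
    by (metis power_eq_if zero_less_card_finite less_irrefl)
  also have "(\<Prod>y\<in>UNIV-{0}. x * y) = (\<Prod>y\<in>UNIV-{0}. y)"
    by (rule prod.reindex_bij_witness[of _ "\<lambda>y. y / x" "\<lambda>y. x * y"]) (use False in auto)
  finally show ?thesis by simp
qed simp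

text \<open>
  The polynomial \<open>(X + 1)\<^sup>q - X\<^sup>q - 1\<close> has degree less than \<open>q\<close> and vanishes at all \<open>q\<close> elements of the field,
  so it is zero.
\<close>

lemma binomial_vanishes:
  fixes k :: nat
  assumes "0 < k" "k < CARD('f::{field,finite})"
  shows "of_nat (CARD('f) choose k) = (0 :: 'f)"
proof -
  let ?q = "CARD('f)"
  define p :: "'f poly" where "p = (\<Sum>i\<in>{0<..<?q}. Polynomial.monom (of_nat (?q choose i)) i)"
  have "poly p x = 0" for x
  proof -
    have "(x + 1) ^ ?q = (\<Sum>i\<le>?q. of_nat (?q choose i) * x ^ i)"
      by (simp add: binomial_ring)
    also have "{..?q} = insert 0 (insert ?q {0<..<?q})"
      by auto
    also have "(\<Sum>i\<in>\<dots>. of_nat (?q choose i) * x ^ i) = 1 + (x ^ ?q + poly p x)"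
      by (simp add: p_def poly_sum poly_monom)
    finally show ?thesis
      by (simp add: finite_field_power_card)
  qed
  then have "p = 0"
  proof -
    have "Polynomial.degree p \<le> ?q - 1"
      unfolding p_def by (intro degree_sum_le) (auto intro: order_trans[OF degree_monom_le])
    then have "Polynomial.degree p < ?q"
      using assms by linarith
    moreover have "card {x. poly p x = 0} = ?q"
      using \<open>\<And>x. poly p x = 0\<close> by simp
    ultimately show ?thesis
      using card_poly_roots_bound[of p] by fastforce
  qed
  then have "Polynomial.coeff p k = 0" by simp
  moreover have "Polynomial.coeff p k = of_nat (?q choose k)"
    unfolding p_def coeff_sum using assms
    by (subst sum.remove[of _ k]) (auto intro!: sum.neutral)
  ultimately show ?thesis by simp
qed

lemma power_card_add:
  fixes x y :: "'f::{field,finite} alg_closure"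
  shows "(x + y) ^ CARD('f) = x ^ CARD('f) + y ^ CARD('f)"
proof -
  let ?q = "CARD('f)"
  have 0: "of_nat (?q choose i) = (0 :: 'f alg_closure)" if "0 < i" "i < ?q" for i
    using arg_cong[OF binomial_vanishes[OF that], of to_ac] by simp
  have "(x + y) ^ ?q = (\<Sum>i\<le>?q. of_nat (?q choose i) * x ^ i * y ^ (?q - i))"
    by (rule binomial_ring)
  also have "{..?q} = insert 0 (insert ?q {0<..<?q})"
    by auto
  also have "(\<Sum>i\<in>\<dots>. of_nat (?q choose i) * x ^ i * y ^ (?q - i)) = y ^ ?q + x ^ ?q"
    by (simp add: 0)
  finally show ?thesis by (simp add: add.commute)
qed

lemma card_fixed_by_frobenius:
  "card {x :: 'f::{field,finite} alg_closure. x ^ CARD('f) = x} = CARD('f)"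
proof (rule antisym)
  let ?q = "CARD('f)" and ?F = "{x :: 'f alg_closure. x ^ CARD('f) = x}"
  have q: "1 < ?q"
    using card_mono[of UNIV "{0, 1 :: 'f}"] by simp
  define p :: "'f alg_closure poly" where "p = Polynomial.monom 1 ?q - Polynomial.monom 1 1"
  have "Polynomial.coeff p ?q = 1"
    using q by (simp add: p_def)
  then have p: "p \<noteq> 0" by auto
  have "?F = {x. poly p x = 0}"
    by (simp add: p_def poly_monom)
  moreover have "Polynomial.degree p \<le> ?q"
    unfolding p_def using q by (intro degree_diff_le) (auto intro: order_trans[OF degree_monom_le])
  ultimately have fin: "finite ?F" and "card ?F \<le> ?q"
    using card_poly_roots_bound[OF p] poly_roots_finite[OF p] by simp_all
  then show "card ?F \<le> ?q" by blast
  have "range (to_ac :: 'f \<Rightarrow> _) \<subseteq> ?F"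
    by (auto simp: to_ac_power[symmetric] finite_field_power_card)
  moreover have "inj (to_ac :: 'f \<Rightarrow> _)"
    by (rule injI) simp
  ultimately show "?q \<le> card ?F"
    using card_mono[OF fin, of "range (to_ac :: 'f \<Rightarrow> _)"] by (simp add: card_image)
qed

definition fvec :: "nat \<Rightarrow> 'k::field ^ 2 \<Rightarrow> 'k ^ 2" where
  "fvec q v = (\<chi> i. (v $ i) ^ q)"

definition fmat :: "nat \<Rightarrow> 'k::field ^ 2 ^ 2 \<Rightarrow> 'k ^ 2 ^ 2" where
  "fmat q A = (\<chi> i j. (A $ i $ j) ^ q)"

text \<open>
  Over an algebraically closed field, additivity makes the \<open>q\<close>-power map a field automorphism: injective
  since \<open>x\<^sup>q - y\<^sup>q = (x - y)\<^sup>q\<close>, and surjective since roots exist.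
\<close>

locale frobenius =
  fixes q :: nat and K :: "'k::alg_closed_field itself"
  assumes q_pos: "0 < q"
    and q_power_add: "\<And>x y :: 'k. (x + y) ^ q = x ^ q + y ^ q"
begin

lemma q_power_diff: "(x - y) ^ q = x ^ q - y ^ q" for x y :: 'k
  using q_power_add[of "x - y" y] by (simp add: algebra_simps)

lemma q_power_eq: "x ^ q = y ^ q \<longleftrightarrow> x = y" for x y :: 'k
  using q_power_diff[of x y] q_pos by auto

lemma q_root: "\<exists>y. y ^ q = (x :: 'k)"
  using q_pos by (rule nth_root_exists)

lemma frob_line: "frob_P1 q (line v) = line (fvec q v :: 'k ^ 2)"
proof -
  have "frob_P1 q (line v) = (\<lambda>d. d *s fvec q v) ` range (\<lambda>c. c ^ q)"
    by (auto simp: frob_P1_def line_def fvec_def image_image vec_eq2 power_mult_distrib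
        intro!: image_cong)
  moreover have "range (\<lambda>c :: 'k. c ^ q) = UNIV"
    using q_root by (metis surjI surj_def)
  ultimately show ?thesis by (simp add: line_def)
qed

lemma fvec_nonzero: "(v :: 'k ^ 2) \<noteq> 0 \<Longrightarrow> fvec q v \<noteq> 0"
  using q_pos by (auto simp: fvec_def vec_eq2)

lemma frob_P1_P1: "L \<in> P1 \<Longrightarrow> frob_P1 q L \<in> (P1 :: ('k ^ 2) set set)"
proof -
  assume "L \<in> P1"
  then obtain v where "v \<noteq> 0" "L = line v" by (rule P1_cases)
  then show ?thesis
    using fvec_nonzero by (simp add: frob_line line_in_P1)
qed

lemma frob_inj:
  assumes "L \<in> P1" "L' \<in> P1" "frob_P1 q L = (frob_P1 q L' :: ('k ^ 2) set)"
  shows "L = L'"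
proof -
  obtain v w where vw: "v \<noteq> 0" "L = line v" "w \<noteq> 0" "L' = line w"
    using assms(1,2) by (metis P1_cases)
  then have "(v $ 1 * w $ 2) ^ q = (v $ 2 * w $ 1) ^ q"
    using assms(3) fvec_nonzero by (simp add: frob_line line_eq_iff_det) (simp add: fvec_def power_mult_distrib)
  then show ?thesis
    using vw by (simp add: q_power_eq line_eq_iff_det)
qed

lemma frob_pts: "frob_P1 q pt_inf = (pt_inf :: ('k ^ 2) set)" "frob_P1 q (pt (x :: 'k)) = pt (x ^ q)"
proof -
  have "fvec q (vec2 1 0) = (vec2 1 0 :: 'k ^ 2)" "fvec q (vec2 x 1) = vec2 (x ^ q) 1"
    using q_pos by (simp_all add: fvec_def vec_eq2)
  then show "frob_P1 q pt_inf = (pt_inf :: ('k ^ 2) set)" "frob_P1 q (pt x) = pt (x ^ q)"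
    by (simp_all add: frob_line)
qed

text \<open>
  Frobenius is semilinear: it turns the action of \<open>A\<close> into that of the matrix of \<open>q\<close>-th powers.
\<close>

lemma frob_act:
  assumes "L \<in> P1"
  shows "frob_P1 q (act A L) = (act (fmat q A) (frob_P1 q L) :: ('k ^ 2) set)"
proof -
  obtain v where v: "L = line v" using assms by (rule P1_cases)
  have "fvec q (A *v v) = fmat q A *v fvec q v"
    by (simp add: vec_eq2 fvec_def fmat_def mat_mult_nth2 q_power_add power_mult_distrib)
  then show ?thesis
    unfolding v by (simp add: act_line frob_line)
qed

lemma invertible_fmat: "invertible (fmat q A) \<longleftrightarrow> invertible (A :: 'k ^ 2 ^ 2)"
proof -
  have "det (fmat q A) = det A ^ q"
    by (simp add: det_2 fmat_def q_power_diff power_mult_distrib)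
  then show ?thesis using q_pos by (simp add: invertible_det_nz)
qed

lemma fmat_surj: "\<exists>A. fmat q A = (B :: 'k ^ 2 ^ 2)"
proof -
  obtain r where r: "\<And>x :: 'k. r x ^ q = x" using q_root by metis
  have "fmat q (\<chi> i j. r (B $ i $ j)) = B"
    by (simp add: fmat_def vec_eq_iff r)
  then show ?thesis by blast
qed

lemma rational_points:
  "{L \<in> P1. frob_P1 q L = L} = insert pt_inf (pt ` {x :: 'k. x ^ q = x})"
  unfolding P1_pts using frob_pts by auto

end

section \<open>Colorings with three prescribed colors\<close>

text \<open>
  Three transpositions suffice: each one moves the next color of the triple to its place, and the
  later ones leave the colors already placed alone.
\<close>

lemma permutation_between_triples:
  assumes "{x, y, w, x', y', w'} \<subseteq> C" "distinct [x, y, w]" "distinct [x', y', w']"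
  obtains \<pi> where "bij_betw \<pi> C C" "\<pi> x = x'" "\<pi> y = y'" "\<pi> w = w'"
proof -
  have swap: "bij_betw (Transposition.transpose s t) C C" if "s \<in> C" "t \<in> C" for s t
    using that by (intro bij_betw_byWitness[where f' = "Transposition.transpose s t"])
      (auto simp: Transposition.transpose_def)
  let ?t1 = "Transposition.transpose x x'"
  define y1 where "y1 = ?t1 y"
  let ?t2 = "Transposition.transpose y1 y'"
  define w2 where "w2 = ?t2 (?t1 w)"
  let ?t3 = "Transposition.transpose w2 w'"
  have 1: "bij_betw ?t1 C C" using swap assms(1) by simp
  have "y1 \<in> C" using bij_betw_apply[OF 1] assms(1) by (simp add: y1_def)
  then have 2: "bij_betw ?t2 C C" using swap assms(1) by simp
  have "w2 \<in> C" using bij_betw_apply[OF 2] bij_betw_apply[OF 1] assms(1) by (simp add: w2_def)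
  then have 3: "bij_betw ?t3 C C" using swap assms(1) by simp
  have y1: "y1 \<noteq> x'" using assms(2) by (auto simp: y1_def Transposition.transpose_def split: if_splits)
  have w1: "?t1 w \<noteq> x'" "?t1 w \<noteq> y1"
    using assms(2) by (auto simp: y1_def Transposition.transpose_def split: if_splits)
  have w2: "w2 \<noteq> x'" "w2 \<noteq> y'"
    using w1 y1 assms(3) by (auto simp: w2_def Transposition.transpose_def split: if_splits)
  show ?thesis
  proof (rule that[of "?t3 \<circ> (?t2 \<circ> ?t1)"])
    show "bij_betw (?t3 \<circ> (?t2 \<circ> ?t1)) C C"
      by (rule bij_betw_trans[OF bij_betw_trans[OF 1 2] 3])
    show "(?t3 \<circ> (?t2 \<circ> ?t1)) x = x'"
      using y1 w2 assms(3) by (simp add: Transposition.transpose_def)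
    show "(?t3 \<circ> (?t2 \<circ> ?t1)) y = y'"
      using w2 assms(3) by (simp add: y1_def[symmetric])
    show "(?t3 \<circ> (?t2 \<circ> ?t1)) w = w'"
      by (simp add: w2_def[symmetric])
  qed
qed

lemma proper_coloring_permuted:
  assumes wf: "\<And>e. e \<in> edges G \<Longrightarrow> ends G e \<subseteq> verts G"
    and \<pi>: "inj_on \<pi> C" "\<pi> ` C \<subseteq> C'"
    and f: "f \<in> proper_colorings G C"
  shows "(\<lambda>v \<in> verts G. \<pi> (f v)) \<in> proper_colorings G C'"
proof -
  have fC: "f v \<in> C" if "v \<in> verts G" for v
    using f that by (auto simp: proper_colorings_def)
  have "(\<lambda>v \<in> verts G. \<pi> (f v)) u \<noteq> (\<lambda>v \<in> verts G. \<pi> (f v)) v"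
    if e: "e \<in> edges G" "ends G e = {u, v}" for e u v
  proof -
    have uv: "u \<in> verts G" "v \<in> verts G"
      using wf[OF e(1)] e(2) by auto
    have "f u \<noteq> f v"
      using f e unfolding proper_colorings_def by blast
    then show ?thesis
      using uv fC \<pi>(1) by (simp add: inj_on_eq_iff)
  qed
  moreover have "(\<lambda>v \<in> verts G. \<pi> (f v)) \<in> verts G \<rightarrow>\<^sub>E C'"
    using fC \<pi>(2) by auto
  ultimately show ?thesis
    unfolding proper_colorings_def by blast
qed

lemma proper_colorings_ends_differ:
  assumes "f \<in> proper_colorings G C" "e \<in> edges G" "ends G e = {u, v}"
  shows "f u \<noteq> f v"
  using assms unfolding proper_colorings_def by blast

lemma proper_colorings_ext:
  assumes "f \<in> proper_colorings G C" "f' \<in> proper_colorings G C'" "\<And>v. v \<in> verts G \<Longrightarrow> f v = f' v"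
  shows "f = f'"
  using assms by (intro extensionalityI[of _ "verts G"]) (auto simp: proper_colorings_def PiE_def)

lemma card_normalised_le:
  assumes wf: "\<And>e. e \<in> edges G \<Longrightarrow> ends G e \<subseteq> verts G"
    and fin: "finite (proper_colorings G C)"
    and abc: "{a, b, c} \<subseteq> verts G"
    and t: "{x, y, w, x', y', w'} \<subseteq> C" "distinct [x, y, w]" "distinct [x', y', w']"
  shows "card {f \<in> proper_colorings G C. f a = x \<and> f b = y \<and> f c = w} \<le>
    card {f \<in> proper_colorings G C. f a = x' \<and> f b = y' \<and> f c = w'}"
proof -
  obtain \<pi> where \<pi>: "bij_betw \<pi> C C" "\<pi> x = x'" "\<pi> y = y'" "\<pi> w = w'"
    by (rule permutation_between_triples[OF t])
  have inj: "inj_on \<pi> C" and sub: "\<pi> ` C \<subseteq> C"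
    using \<pi>(1) by (auto simp: bij_betw_def)
  show ?thesis
  proof (rule card_inj_on_le[where f = "\<lambda>f. \<lambda>v \<in> verts G. \<pi> (f v)"])
    show "inj_on (\<lambda>f. \<lambda>v \<in> verts G. \<pi> (f v)) {f \<in> proper_colorings G C. f a = x \<and> f b = y \<and> f c = w}"
    proof (rule inj_onI)
      fix f f'
      assume f: "f \<in> {f \<in> proper_colorings G C. f a = x \<and> f b = y \<and> f c = w}"
        and f': "f' \<in> {f \<in> proper_colorings G C. f a = x \<and> f b = y \<and> f c = w}"
        and eq: "(\<lambda>v \<in> verts G. \<pi> (f v)) = (\<lambda>v \<in> verts G. \<pi> (f' v))"
      have "f v = f' v" if v: "v \<in> verts G" for v
      proof -
        have "f v \<in> C" "f' v \<in> C"
          using f f' v by (auto simp: proper_colorings_def)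
        moreover have "\<pi> (f v) = \<pi> (f' v)"
          using fun_cong[OF eq, of v] v by simp
        ultimately show ?thesis using inj by (simp add: inj_on_eq_iff)
      qed
      then show "f = f'"
        using f f' proper_colorings_ext[of f G C f' C] by blast
    qed
    show "(\<lambda>f. \<lambda>v \<in> verts G. \<pi> (f v)) ` {f \<in> proper_colorings G C. f a = x \<and> f b = y \<and> f c = w}
      \<subseteq> {f \<in> proper_colorings G C. f a = x' \<and> f b = y' \<and> f c = w'}"
    proof (rule image_subsetI)
      fix f assume f: "f \<in> {f \<in> proper_colorings G C. f a = x \<and> f b = y \<and> f c = w}"
      then have "(\<lambda>v \<in> verts G. \<pi> (f v)) \<in> proper_colorings G C"
        by (intro proper_coloring_permuted[OF wf inj sub]) simp_all
      then show "(\<lambda>v \<in> verts G. \<pi> (f v)) \<in>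
          {f \<in> proper_colorings G C. f a = x' \<and> f b = y' \<and> f c = w'}"
        using f abc \<pi>(2-4) by simp
    qed
    show "finite {f \<in> proper_colorings G C. f a = x' \<and> f b = y' \<and> f c = w'}"
      using fin by simp
  qed
qed

text \<open>
  At three mutually adjacent vertices, a proper coloring shows one of the \<open>n (n - 1) (n - 2)\<close> triples of
  distinct colors, where \<open>n = card C\<close>.  By permuting the colors, all triples occur equally often.
\<close>

lemma card_normalised_colorings:
  fixes C :: "'c set"
  assumes finG: "finite (verts G)" and wf: "\<And>e. e \<in> edges G \<Longrightarrow> ends G e \<subseteq> verts G"
    and C: "finite C"
    and abc: "{a, b, c} \<subseteq> verts G" "{e, e', e''} \<subseteq> edges G"
      "ends G e = {b, c}" "ends G e' = {a, c}" "ends G e'' = {a, b}"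
    and t: "{x, y, w} \<subseteq> C" "distinct [x, y, w]"
  shows "card (proper_colorings G C) = card C * (card C - 1) * (card C - 2) *
    card {f \<in> proper_colorings G C. f a = x \<and> f b = y \<and> f c = w}"
proof -
  define T where "T = Sigma C (\<lambda>x. Sigma (C - {x}) (\<lambda>y. C - {x, y}))"
  define fib where "fib = (\<lambda>(x, y, w). {f \<in> proper_colorings G C. f a = x \<and> f b = y \<and> f c = w})"
  have fin: "finite (proper_colorings G C)"
    by (rule finite_subset[of _ "verts G \<rightarrow>\<^sub>E C"])
      (use finG C in \<open>auto simp: proper_colorings_def finite_PiE\<close>)
  have finT: "finite T" using C by (simp add: T_def)
  have cardT: "card T = card C * (card C - 1) * (card C - 2)"
  proof -
    have "card (C - {x, y}) = card C - 2" if "x \<in> C" "y \<in> C - {x}" for x y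
      using that C by (subst card_Diff_subset) auto
    then have "card (Sigma (C - {x}) (\<lambda>y. C - {x, y})) = (card C - 1) * (card C - 2)" if "x \<in> C" for x
      using that C by (subst card_SigmaI) auto
    then show ?thesis
      unfolding T_def using C by (subst card_SigmaI) auto
  qed
  have "proper_colorings G C = (\<Union>s\<in>T. fib s)"
  proof
    show "proper_colorings G C \<subseteq> (\<Union>s\<in>T. fib s)"
    proof
      fix f assume f: "f \<in> proper_colorings G C"
      have "f b \<noteq> f c" "f a \<noteq> f c" "f a \<noteq> f b"
        using proper_colorings_ends_differ[OF f] abc(2-5) by auto
      moreover have "f a \<in> C" "f b \<in> C" "f c \<in> C"
        using f abc(1) by (auto simp: proper_colorings_def)
      ultimately have "(f a, f b, f c) \<in> T" by (auto simp: T_def)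
      moreover have "f \<in> fib (f a, f b, f c)" using f by (simp add: fib_def)
      ultimately show "f \<in> (\<Union>s\<in>T. fib s)" by blast
    qed
  qed (auto simp: fib_def)
  also have "card \<dots> = (\<Sum>s\<in>T. card (fib s))"
    by (rule card_UN_disjoint) (use finT fin in \<open>auto simp: fib_def\<close>)
  also have "\<dots> = (\<Sum>s\<in>T. card (fib (x, y, w)))"
  proof (rule sum.cong)
    fix s assume "s \<in> T"
    then obtain x' y' w' where s: "s = (x', y', w')" "{x', y', w'} \<subseteq> C" "distinct [x', y', w']"
      by (auto simp: T_def)
    have sub: "{x, y, w, x', y', w'} \<subseteq> C" "{x', y', w', x, y, w} \<subseteq> C"
      using t(1) s(2) by auto
    show "card (fib s) = card (fib (x, y, w))"
      unfolding s(1) fib_def prod.case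
      by (intro antisym card_normalised_le wf fin abc(1) sub t(2) s(3))
  qed simp
  also have "\<dots> = card T * card (fib (x, y, w))" by simp
  finally show ?thesis unfolding cardT by (simp add: fib_def)
qed

section \<open>Orbits of colorings\<close>

lemma M_fr_colorings: "M_fr G = proper_colorings (dual_graph G) P1"
  by (simp add: M_fr_def proper_colorings_def dual_graph_def)

definition act_coloring :: "sphere_graph \<Rightarrow> 'k::field ^ 2 ^ 2 \<Rightarrow>
    ((real^3) set \<Rightarrow> ('k ^ 2) set) \<Rightarrow> ((real^3) set \<Rightarrow> ('k ^ 2) set)" where
  "act_coloring G A z = (\<lambda>a \<in> faces G. act A (z a))"

lemma M_fr_P1: "z \<in> M_fr G \<Longrightarrow> a \<in> faces G \<Longrightarrow> z a \<in> P1"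
  by (auto simp: M_fr_def)

lemma dual_ends: "ends (dual_graph G) e \<subseteq> verts (dual_graph G)"
  by (auto simp: dual_graph_def sides_def)

lemma act_coloring_M_fr:
  assumes "invertible A" "z \<in> M_fr G"
  shows "act_coloring G A z \<in> M_fr G"
proof -
  have "(\<lambda>a \<in> verts (dual_graph G). act A (z a)) \<in> proper_colorings (dual_graph G) P1"
    by (rule proper_coloring_permuted[where C = P1 and \<pi> = "act A" and f = z])
      (use assms act_inj act_P1 dual_ends in \<open>auto simp: M_fr_colorings inj_on_def\<close>)
  then show ?thesis
    by (simp add: M_fr_colorings act_coloring_def dual_graph_def)
qed

lemma act_coloring_mult:
  "act_coloring G A (act_coloring G B z) = act_coloring G (A ** B) z"
  by (simp add: act_coloring_def act_mult fun_eq_iff)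

lemma act_coloring_one: "z \<in> M_fr G \<Longrightarrow> act_coloring G (mat 1) z = z"
  by (auto simp: act_coloring_def act_one M_fr_def PiE_def extensional_def fun_eq_iff)

lemma same_orbit_iff:
  "(z, w) \<in> same_orbit G \<longleftrightarrow> z \<in> M_fr G \<and> (\<exists>A. invertible A \<and> w = act_coloring G A z)"
proof -
  have eq: "(\<lambda>a \<in> faces G. (\<lambda>L \<in> P1. (\<lambda>v. A *v v) ` L) (z a)) = act_coloring G A z"
    if "z \<in> M_fr G" for A
    using M_fr_P1[OF that] by (auto simp: act_coloring_def act_def fun_eq_iff)
  have "(\<exists>\<phi> \<in> PGL2. w = (\<lambda>a \<in> faces G. \<phi> (z a))) \<longleftrightarrow> (\<exists>A. invertible A \<and> w = act_coloring G A z)"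
    if "z \<in> M_fr G"
    unfolding PGL2_def eq[OF that, symmetric] by blast
  then show ?thesis
    unfolding same_orbit_def using act_coloring_M_fr by blast
qed

lemma equiv_same_orbit: "equiv (M_fr G) (same_orbit G)"
proof (rule equivI)
  show "same_orbit G \<subseteq> M_fr G \<times> M_fr G"
    by (auto simp: same_orbit_def)
  show "refl_on (M_fr G) (same_orbit G)"
  proof (rule refl_onI)
    fix z :: "(real^3) set \<Rightarrow> ('k::field ^ 2) set"
    assume z: "z \<in> M_fr G"
    have "invertible (mat 1 :: 'k ^ 2 ^ 2)"
      unfolding invertible_def by (intro exI[of _ "mat 1"]) simp
    then show "(z, z) \<in> same_orbit G"
      using z act_coloring_one[OF z] unfolding same_orbit_iff by metis
  qed
  show "sym (same_orbit G)"
  proof (rule symI)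
    fix z w :: "(real^3) set \<Rightarrow> ('k::field ^ 2) set"
    assume "(z, w) \<in> same_orbit G"
    then obtain A where A: "z \<in> M_fr G" "invertible A" "w = act_coloring G A z"
      by (auto simp: same_orbit_iff)
    obtain B where "invertible B" "B ** A = mat 1"
      by (rule inverse_matrix[OF A(2)])
    then have "z = act_coloring G B w"
      using A by (simp add: act_coloring_mult act_coloring_one)
    then show "(w, z) \<in> same_orbit G"
      using A act_coloring_M_fr \<open>invertible B\<close> by (auto simp: same_orbit_iff)
  qed
  show "trans (same_orbit G)"
    by (rule transI) (metis same_orbit_iff act_coloring_mult invertible_mult)
qed

context frobenius
begin

lemma frob_coloring_M_fr:
  assumes "z \<in> M_fr G"
  shows "frob q G z \<in> (M_fr G :: (_ \<Rightarrow> ('k ^ 2) set) set)"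
proof -
  have "(\<lambda>a \<in> verts (dual_graph G). frob_P1 q (z a)) \<in> proper_colorings (dual_graph G) P1"
    by (rule proper_coloring_permuted[where C = P1 and \<pi> = "frob_P1 q" and f = z])
      (use assms frob_inj frob_P1_P1 dual_ends in \<open>auto simp: M_fr_colorings inj_on_def\<close>)
  then show ?thesis
    by (simp add: M_fr_colorings frob_def dual_graph_def)
qed

lemma frob_act_coloring:
  assumes "z \<in> M_fr G"
  shows "frob q G (act_coloring G A z) = (act_coloring G (fmat q A) (frob q G z) :: _ \<Rightarrow> ('k ^ 2) set)"
  using M_fr_P1[OF assms] by (auto simp: frob_def act_coloring_def frob_act fun_eq_iff)

definition normalised :: "sphere_graph \<Rightarrow> (real^3) set \<Rightarrow> (real^3) set \<Rightarrow> (real^3) set \<Rightarrow>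
    ((real^3) set \<Rightarrow> ('k ^ 2) set) set" where
  "normalised G a b c = {z \<in> M_fr G. z a = pt_inf \<and> z b = pt 0 \<and> z c = pt 1}"

text \<open>
  Freeness of the action: a matrix that carries one normalised coloring to another one fixes \<open>pt_inf\<close>,
  \<open>pt 0\<close> and \<open>pt 1\<close>.
\<close>

lemma normalised_unique:
  assumes abc: "{a, b, c} \<subseteq> faces G"
    and z: "z \<in> normalised G a b c" "w \<in> normalised G a b c" and "(z, w) \<in> same_orbit G"
  shows "w = z"
proof -
  obtain A where A: "z \<in> M_fr G" "invertible A" "w = act_coloring G A z"
    using assms(4) by (auto simp: same_orbit_iff)
  have w: "w d = act A (z d)" if "d \<in> faces G" for d
    using A(3) that by (simp add: act_coloring_def)
  have "act A pt_inf = pt_inf" "act A (pt 0) = pt 0" "act A (pt 1) = pt 1"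
    using w[of a] w[of b] w[of c] abc z by (simp_all add: normalised_def)
  then have "act A (z d) = z d" if "d \<in> faces G" for d
    using fixing_standard_is_trivial[OF _ _ _ A(2) M_fr_P1[OF A(1) that]] by blast
  then have "w d = z d" if "d \<in> faces G" for d
    using w that by simp
  then show ?thesis
    using z by (intro proper_colorings_ext[of w "dual_graph G" P1 z P1])
      (auto simp: normalised_def M_fr_colorings dual_graph_def)
qed

lemma normalised_exists:
  assumes abc: "{a, b, c} \<subseteq> faces G"
    and z: "z \<in> M_fr G" and ne: "z a \<noteq> z b" "z a \<noteq> z c" "z b \<noteq> z c"
  obtains w where "w \<in> normalised G a b c" "(z, w) \<in> same_orbit G"
proof -
  have "z a \<in> P1" "z b \<in> P1" "z c \<in> P1"
    using M_fr_P1[OF z] abc by simp_all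
  then obtain A where A: "invertible A" "act A (z a) = pt_inf" "act A (z b) = pt 0" "act A (z c) = pt 1"
    using move_to_standard ne by metis
  show ?thesis
  proof (rule that)
    show "(z, act_coloring G A z) \<in> same_orbit G"
      using z A(1) by (auto simp: same_orbit_iff)
    show "act_coloring G A z \<in> normalised G a b c"
      using A abc act_coloring_M_fr[OF A(1) z] by (simp add: normalised_def act_coloring_def)
  qed
qed

lemma frob_normalised:
  assumes "{a, b, c} \<subseteq> faces G" "z \<in> normalised G a b c"
  shows "frob q G z \<in> normalised G a b c"
  using assms frob_coloring_M_fr q_pos by (simp add: normalised_def frob_def frob_pts)

text \<open>
  The elements of the orbit are \<open>A \<cdot> w\<close>, and Frobenius maps \<open>A \<cdot> w\<close> to \<open>A' \<cdot> w\<close>, where the entries of \<open>A'\<close> are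
  the \<open>q\<close>-th powers of those of \<open>A\<close>.  As the field is algebraically closed, every invertible matrix
  arises as \<open>A'\<close>.
\<close>

lemma frob_orbit:
  assumes w: "w \<in> M_fr G" "frob q G w = w"
  shows "frob q G ` (same_orbit G `` {w}) = same_orbit G `` {w :: _ \<Rightarrow> ('k ^ 2) set}"
proof -
  have orb: "same_orbit G `` {w} = (\<lambda>A. act_coloring G A w) ` {A. invertible A}"
    using w(1) by (auto simp: same_orbit_iff)
  have "frob q G (act_coloring G A w) = act_coloring G (fmat q A) w" for A
    using frob_act_coloring[OF w(1)] w(2) by simp
  then have "frob q G ` (same_orbit G `` {w}) = (\<lambda>A. act_coloring G A w) ` fmat q ` {A. invertible A}"
    unfolding orb by (simp add: image_image)
  also have "fmat q ` {A. invertible A} = {A :: 'k ^ 2 ^ 2. invertible A}"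
    using fmat_surj invertible_fmat by (auto simp: image_iff) metis
  finally show ?thesis unfolding orb .
qed

text \<open>
  Every orbit contains exactly one normalised coloring \<open>w\<close>.  Frobenius preserves normalised colorings,
  because it fixes \<open>pt_inf\<close>, \<open>pt 0\<close> and \<open>pt 1\<close>.  Hence it preserves the orbit of \<open>w\<close> iff it fixes \<open>w\<close>.
\<close>

lemma rational_orbits:
  assumes abc: "{a, b, c} \<subseteq> faces G" "{e, e', e''} \<subseteq> edges G"
      "sides G e = {b, c}" "sides G e' = {a, c}" "sides G e'' = {a, b}"
  shows "bij_betw (\<lambda>w. same_orbit G `` {w})
    {w \<in> normalised G a b c. frob q G w = w}
    {orb \<in> M_geom G. frob q G ` orb = (orb :: (_ \<Rightarrow> ('k ^ 2) set) set)}"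
proof (rule bij_betw_imageI)
  let ?T = "{w \<in> normalised G a b c. frob q G w = w}"
  have norm_M_fr: "w \<in> M_fr G" if "w \<in> normalised G a b c" for w
    using that by (simp add: normalised_def)
  show "inj_on (\<lambda>w. same_orbit G `` {w}) ?T"
  proof (rule inj_onI)
    fix z w assume z: "z \<in> ?T" and w: "w \<in> ?T" and eq: "same_orbit G `` {z} = same_orbit G `` {w}"
    have "(z, w) \<in> same_orbit G"
      using eq_equiv_class[OF eq equiv_same_orbit] norm_M_fr w by blast
    then show "z = w"
      using normalised_unique[OF abc(1)] z w by blast
  qed
  show "(\<lambda>w. same_orbit G `` {w}) ` ?T = {orb \<in> M_geom G. frob q G ` orb = orb}"
  proof
    show "(\<lambda>w. same_orbit G `` {w}) ` ?T \<subseteq> {orb \<in> M_geom G. frob q G ` orb = orb}"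
    proof (rule image_subsetI)
      fix w assume w: "w \<in> ?T"
      then have "w \<in> M_fr G" "frob q G w = w" using norm_M_fr by simp_all
      then show "same_orbit G `` {w} \<in> {orb \<in> M_geom G. frob q G ` orb = orb}"
        using frob_orbit by (simp add: M_geom_def quotientI)
    qed
    show "{orb \<in> M_geom G. frob q G ` orb = orb} \<subseteq> (\<lambda>w. same_orbit G `` {w}) ` ?T"
    proof
      fix orb :: "((real^3) set \<Rightarrow> ('k ^ 2) set) set"
      assume "orb \<in> {orb \<in> M_geom G. frob q G ` orb = orb}"
      then obtain z where z: "z \<in> M_fr G" "orb = same_orbit G `` {z}" and fixed: "frob q G ` orb = orb"
        by (auto simp: M_geom_def elim!: quotientE)
      have "z u \<noteq> z v" if "d \<in> edges G" "sides G d = {u, v}" for d u v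
        using z(1) that unfolding M_fr_def by blast
      then have ne: "z a \<noteq> z b" "z a \<noteq> z c" "z b \<noteq> z c"
        using abc(2-5) by auto
      obtain w where w: "w \<in> normalised G a b c" "(z, w) \<in> same_orbit G"
        by (rule normalised_exists[OF abc(1) z(1) ne])
      have orb: "orb = same_orbit G `` {w}"
        using equiv_class_eq[OF equiv_same_orbit w(2)] z(2) by simp
      have "w \<in> orb" using w(2) z(2) by blast
      then have "frob q G w \<in> orb" using fixed by blast
      then have "(w, frob q G w) \<in> same_orbit G" using orb by blast
      then have "frob q G w = w"
        by (rule normalised_unique[OF abc(1) w(1) frob_normalised[OF abc(1) w(1)]])
      then show "orb \<in> (\<lambda>w. same_orbit G `` {w}) ` ?T"
        using w(1) orb by blast
    qed
  qed
qed

text \<open>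
  A coloring is fixed by Frobenius iff all its values are; so the fixed normalised colorings are
  counted by a coloring problem with finitely many colors.
\<close>

lemma fixed_normalised_colorings:
  assumes "{a, b, c} \<subseteq> faces G"
  shows "{w \<in> normalised G a b c. frob q G w = w} =
    {w \<in> proper_colorings (dual_graph G) {L \<in> P1. frob_P1 q L = L}.
      w a = (pt_inf :: ('k ^ 2) set) \<and> w b = pt 0 \<and> w c = pt 1}"
proof -
  have "w \<in> M_fr G \<and> frob q G w = w \<longleftrightarrow>
      w \<in> proper_colorings (dual_graph G) {L \<in> P1. frob_P1 q L = (L :: ('k ^ 2) set)}" for w
  proof -
    have "frob q G w = w \<longleftrightarrow> (\<forall>d \<in> faces G. frob_P1 q (w d) = w d)" if "w \<in> faces G \<rightarrow>\<^sub>E P1"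
      using that by (auto simp: frob_def fun_eq_iff PiE_def extensional_def)
    then show ?thesis
      unfolding M_fr_def proper_colorings_def dual_graph_def
      by (auto simp: PiE_iff)
  qed
  then show ?thesis
    unfolding normalised_def by blast
qed

end

lemma frobenius_alg_closure: "frobenius TYPE('f::{field,finite} alg_closure) CARD('f)"
  by (rule frobenius.intro) (simp_all add: power_card_add)

lemma card_rational_points:
  "card {L \<in> P1. frob_P1 CARD('f) L = (L :: ('f::{field,finite} alg_closure ^ 2) set)} = CARD('f) + 1"
proof -
  interpret frobenius "CARD('f)" "TYPE('f alg_closure)"
    by (rule frobenius_alg_closure)
  have "finite {x :: 'f alg_closure. x ^ CARD('f) = x}"
    using card_fixed_by_frobenius[where 'f = 'f] by (intro card_ge_0_finite) simp
  moreover have "inj (pt :: 'f alg_closure \<Rightarrow> _)"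
    by (rule injI) simp
  ultimately show ?thesis
    unfolding rational_points
    by (subst card_insert_disjoint) (auto simp: card_image inj_on_subset card_fixed_by_frobenius)
qed

theorem proposition1p2:
  fixes \<Gamma> :: sphere_graph and q :: nat
  assumes "cubic_planar_graph \<Gamma>"
    and "simple_mgraph \<Gamma>"
    and "q = CARD('f::{field, finite})"
  shows "finite (M_points TYPE('f) \<Gamma>) \<and>
         real (card (M_points TYPE('f) \<Gamma>)) =
           1 / (real q ^ 3 - real q) * poly (chromatic_poly (dual_graph \<Gamma>)) (real q + 1)"
proof -
  let ?D = "dual_graph \<Gamma>"
  let ?Q = "{L \<in> P1. frob_P1 CARD('f) L = (L :: ('f alg_closure ^ 2) set)}"
  interpret frobenius "CARD('f)" "TYPE('f alg_closure)"
    by (rule frobenius_alg_closure)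
  have emb: "embedded_graph \<Gamma>" and con: "connected_mgraph \<Gamma>" and cub: "cubic \<Gamma>"
    using assms(1) by (simp_all add: cubic_planar_graph_def)
  have q: "1 < q"
    using card_mono[of UNIV "{0, 1 :: 'f}"] assms(3) by simp
  obtain v where v: "v \<in> verts \<Gamma>" "degree_of \<Gamma> v = 3"
    using con cub by (auto simp: connected_mgraph_def cubic_def)
  obtain a b c e e' e'' where abc: "{a, b, c} \<subseteq> faces \<Gamma>" "{e, e', e''} \<subseteq> edges \<Gamma>"
    "sides \<Gamma> e = {b, c}" "sides \<Gamma> e' = {a, c}" "sides \<Gamma> e'' = {a, b}"
    by (rule three_faces_at_vertex[OF emb assms(2) v])
  have finD: "finite (verts ?D)"
    using finite_faces[OF emb assms(2) cub] by (simp add: dual_graph_def)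
  have cardQ: "card ?Q = q + 1"
    using card_rational_points[where 'f = 'f] assms(3) by simp
  then have finQ: "finite ?Q"
    by (intro card_ge_0_finite) simp
  let ?N = "{w \<in> proper_colorings ?D ?Q. w a = pt_inf \<and> w b = pt 0 \<and> w c = pt 1}"
  have bij: "bij_betw (\<lambda>w. same_orbit \<Gamma> `` {w}) ?N (M_points TYPE('f) \<Gamma>)"
    using rational_orbits[OF abc] unfolding fixed_normalised_colorings[OF abc(1)] M_points_def .
  have finN: "finite ?N"
    by (rule finite_subset[of _ "verts ?D \<rightarrow>\<^sub>E ?Q"])
      (use finD finQ in \<open>auto simp: proper_colorings_def finite_PiE\<close>)
  have std: "{pt_inf, pt 0, pt 1} \<subseteq> ?Q"
    unfolding rational_points using q assms(3) by (simp add: power_0_left)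
  have "card (proper_colorings ?D ?Q) = card ?Q * (card ?Q - 1) * (card ?Q - 2) * card ?N"
    by (rule card_normalised_colorings[OF finD dual_ends finQ _ _ _ _ _ std])
      (use abc in \<open>simp_all add: dual_graph_def\<close>)
  also have "card (proper_colorings ?D ?Q) = card (proper_colorings ?D {..<q + 1})"
    using card_proper_colorings[OF finD dual_ends finQ]
      card_proper_colorings[OF finD dual_ends, of "{..<q + 1}"] cardQ by simp
  finally have "card (proper_colorings ?D {..<q + 1}) = (q + 1) * q * (q - 1) * card ?N"
    unfolding cardQ by simp
  moreover have "poly (chromatic_poly ?D) (real (q + 1)) = real (card (proper_colorings ?D {..<q + 1}))"
    by (rule poly_chromatic_poly[OF finD dual_ends])
  ultimately have "poly (chromatic_poly ?D) (real q + 1) = (real q + 1) * real q * (real q - 1) * real (card ?N)"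
    using q by (simp add: of_nat_diff algebra_simps)
  also have "(real q + 1) * real q * (real q - 1) = real q ^ 3 - real q"
    by (simp add: power3_eq_cube algebra_simps)
  finally have "poly (chromatic_poly ?D) (real q + 1) = (real q ^ 3 - real q) * real (card ?N)" .
  moreover have "real q ^ 3 - real q \<noteq> 0"
  proof -
    have "real q ^ 3 > real q ^ 1"
      using q by (intro power_strict_increasing) auto
    then show ?thesis by simp
  qed
  ultimately have "real (card ?N) = 1 / (real q ^ 3 - real q) * poly (chromatic_poly ?D) (real q + 1)"
    by simp
  then show ?thesis
    using bij_betw_same_card[OF bij] bij_betw_finite[OF bij] finN by simp
qed

end
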